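(* Let $\mathbb{G}$ be a Polish group acting continuously on a Polish space $\mathbb{X}$ with generically turbulent action, and let $\mathsf{F}$ be any equivalence relation in Class 4 on a Polish space $\mathbb{Y}$. Then the action is hereditarily generically $\mathsf{F}$-ergodic; consequently the orbit equivalence relation $\mathsf{E}^{\mathbb{X}}_{\mathbb{G}}$ is not reducible to $\mathsf{F}$ by any Baire measurable map.
   Context: Local orbits: for $X\subseteq\mathbb{X}$, $G\subseteq\mathbb{G}$, let $R^G_X=\{\langle x,y\rangle\in X^2:\exists g\in G\,(x=g\cdot y)\}$, $\sim^G_X$ the smallest equivalence relation on $X$ containing $R^G_X$, and $\mathcal{O}(X,G,x)$ the $\sim^G_X$-class of $x\in X$. $\mathsf{E}^{\mathbb{X}}_{\mathbb{G}}=\sim^{\mathbb{G}}_{\mathbb{X}}$ is the orbit equivalence relation. A point $x$ is turbulent if for every open $X\ni x$ and every neighbourhood $G$ of $1_{\mathbb{G}}$, $\mathcal{O}(X,G,x)$ is somewhere dense in $\mathbb{X}$; the action is generically turbulent if the union of all dense, turbulent, meager orbits is comeager. For an equivalence relation $\mathsf{E}$ on a Polish space $X$ (open subsets of Polish spaces being Polish) and $\mathsf{F}$ on $\mathbb{Y}$: a map $\vartheta:X\to\mathbb{Y}$ is $\langle\mathsf{E},\mathsf{F}\rangle$-invariant if $x\,\mathsf{E}\,y\Rightarrow\vartheta(x)\,\mathsf{F}\,\vartheta(y)$; generically $\mathsf{F}$-constant if $\vartheta(x)\,\mathsf{F}\,\vartheta(y)$ for all $x,y$ in a comeager subset of $X$;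 $\mathsf{E}$ is generically $\mathsf{F}$-ergodic if every Baire measurable $\langle\mathsf{E},\mathsf{F}\rangle$-invariant map is generically $\mathsf{F}$-constant. The action is hereditarily generically $\mathsf{F}$-ergodic if $\sim^G_X$ is generically $\mathsf{F}$-ergodic whenever $X\subseteq\mathbb{X}$ is nonempty open, $G\subseteq\mathbb{G}$ is open containing $1_{\mathbb{G}}$, and $\mathcal{O}(X,G,x)$ is dense in $X$ for comeager-in-$X$ many $x\in X$. Class 4 is the least class of equivalence relations on Polish spaces containing the equality on every Polish space and closed under: (e1) countable union (when an equivalence relation) and countable intersection of equivalence relations on one space; (e2) countable disjoint union ($\langle k,x\rangle\,\mathsf{F}\,\langle l,y\rangle$ iff $k=l$ and $x\,\mathsf{F}_k\,y$, on $\bigcup_k\{k\}\times\mathbb{Y}_k$); (e3) products ($x\,\mathsf{F}\,y$ iff $x_k\,\mathsf{F}_k\,y_k$ for all $k$); (e4) Fubini product modulo $\mathrm{Fin}$ ($x\,\mathsf{F}\,y$ iff $\{k:\neg(x_k\,\mathsf{F}_k\,y_k)\}$ is finite); (e5) countable power ($x\,\mathsf{F}^\infty\,y$ on $\mathbb{Y}^{\mathbb{N}}$ iff $\forall k\exists l\,(x_k\,\mathsf{F}\,y_l)$ and $\forall l\exists k\,(x_k\,\mathsf{F}\,y_l)$). *)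

theory Defs
  imports "HOL-Analysis.Analysis" "HOL-Algebra.Group_Action"
begin

definition Polish_space :: "'a topology \<Rightarrow> bool" where
  "Polish_space X \<longleftrightarrow> completely_metrizable_space X \<and> separable_space X"


section \<open>Baire category\<close>

definition nowhere_dense_in :: "'a topology \<Rightarrow> 'a set \<Rightarrow> bool" where
  "nowhere_dense_in X S \<longleftrightarrow> S \<subseteq> topspace X \<and> X interior_of (X closure_of S) = {}"

definition meager_in :: "'a topology \<Rightarrow> 'a set \<Rightarrow> bool" where
  "meager_in X S \<longleftrightarrow> (\<exists>N :: nat \<Rightarrow> 'a set. (\<forall>n. nowhere_dense_in X (N n)) \<and> S \<subseteq> (\<Union>n. N n))"

definition comeager_in :: "'a topology \<Rightarrow> 'a set \<Rightarrow> bool" where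
  "comeager_in X S \<longleftrightarrow> S \<subseteq> topspace X \<and> meager_in X (topspace X - S)"

definition dense_in :: "'a topology \<Rightarrow> 'a set \<Rightarrow> bool" where
  "dense_in X S \<longleftrightarrow> S \<subseteq> topspace X \<and> X closure_of S = topspace X"

definition somewhere_dense_in :: "'a topology \<Rightarrow> 'a set \<Rightarrow> bool" where
  "somewhere_dense_in X S \<longleftrightarrow> S \<subseteq> topspace X \<and> X interior_of (X closure_of S) \<noteq> {}"

definition Baire_property_in :: "'a topology \<Rightarrow> 'a set \<Rightarrow> bool" where
  "Baire_property_in X S \<longleftrightarrow>
     S \<subseteq> topspace X \<and> (\<exists>U. openin X U \<and> meager_in X ((S - U) \<union> (U - S)))"

definition Baire_measurable :: "'a topology \<Rightarrow> 'b topology \<Rightarrow> ('a \<Rightarrow> 'b) \<Rightarrow> bool" where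
  "Baire_measurable X Y \<theta> \<longleftrightarrow>
     \<theta> \<in> topspace X \<rightarrow> topspace Y \<and>
     (\<forall>U. openin Y U \<longrightarrow> Baire_property_in X {x \<in> topspace X. \<theta> x \<in> U})"


section \<open>Invariance, ergodicity and reducibility\<close>

definition invariant_map ::
  "'a topology \<Rightarrow> ('a \<times> 'a) set \<Rightarrow> ('b \<times> 'b) set \<Rightarrow> ('a \<Rightarrow> 'b) \<Rightarrow> bool" where
  "invariant_map X E F \<theta> \<longleftrightarrow>
     (\<forall>x\<in>topspace X. \<forall>y\<in>topspace X. (x, y) \<in> E \<longrightarrow> (\<theta> x, \<theta> y) \<in> F)"

definition generically_constant ::
  "'a topology \<Rightarrow> ('b \<times> 'b) set \<Rightarrow> ('a \<Rightarrow> 'b) \<Rightarrow> bool" where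
  "generically_constant X F \<theta> \<longleftrightarrow>
     (\<exists>C. comeager_in X C \<and> (\<forall>x\<in>C. \<forall>y\<in>C. (\<theta> x, \<theta> y) \<in> F))"

definition generically_ergodic ::
  "'a topology \<Rightarrow> ('a \<times> 'a) set \<Rightarrow> 'b topology \<Rightarrow> ('b \<times> 'b) set \<Rightarrow> bool" where
  "generically_ergodic X E Y F \<longleftrightarrow>
     (\<forall>\<theta>. Baire_measurable X Y \<theta> \<and> invariant_map X E F \<theta> \<longrightarrow> generically_constant X F \<theta>)"

definition Baire_reducible ::
  "'a topology \<Rightarrow> ('a \<times> 'a) set \<Rightarrow> 'b topology \<Rightarrow> ('b \<times> 'b) set \<Rightarrow> bool" where
  "Baire_reducible X E Y F \<longleftrightarrow>
     (\<exists>\<theta>. Baire_measurable X Y \<theta> \<and>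
        (\<forall>x\<in>topspace X. \<forall>y\<in>topspace X. (x, y) \<in> E \<longleftrightarrow> (\<theta> x, \<theta> y) \<in> F))"


section \<open>Polish groups, continuous actions, local orbits and turbulence\<close>

definition Polish_group :: "('g, 'm) monoid_scheme \<Rightarrow> 'g topology \<Rightarrow> bool" where
  "Polish_group G TG \<longleftrightarrow>
     group G \<and> Polish_space TG \<and> topspace TG = carrier G \<and>
     continuous_map (prod_topology TG TG) TG (\<lambda>(g, h). g \<otimes>\<^bsub>G\<^esub> h) \<and>
     continuous_map TG TG (\<lambda>g. inv\<^bsub>G\<^esub> g)"

definition continuous_action ::
  "('g, 'm) monoid_scheme \<Rightarrow> 'g topology \<Rightarrow> 'x topology \<Rightarrow> ('g \<Rightarrow> 'x \<Rightarrow> 'x) \<Rightarrow> bool" where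
  "continuous_action G TG X \<phi> \<longleftrightarrow>
     group_action G (topspace X) \<phi> \<and>
     continuous_map (prod_topology TG X) X (\<lambda>(g, x). \<phi> g x)"

definition local_rel :: "('g \<Rightarrow> 'x \<Rightarrow> 'x) \<Rightarrow> 'g set \<Rightarrow> 'x set \<Rightarrow> ('x \<times> 'x) set" where
  "local_rel \<phi> H S = {(x, y). x \<in> S \<and> y \<in> S \<and> (\<exists>g\<in>H. x = \<phi> g y)}"

definition local_equiv :: "('g \<Rightarrow> 'x \<Rightarrow> 'x) \<Rightarrow> 'g set \<Rightarrow> 'x set \<Rightarrow> ('x \<times> 'x) set" where
  "local_equiv \<phi> H S = \<Inter>{E. equiv S E \<and> local_rel \<phi> H S \<subseteq> E}"

definition local_orbit :: "('g \<Rightarrow> 'x \<Rightarrow> 'x) \<Rightarrow> 'x set \<Rightarrow> 'g set \<Rightarrow> 'x \<Rightarrow> 'x set" where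
  "local_orbit \<phi> S H x = local_equiv \<phi> H S `` {x}"

definition orbit_equiv ::
  "('g, 'm) monoid_scheme \<Rightarrow> 'x topology \<Rightarrow> ('g \<Rightarrow> 'x \<Rightarrow> 'x) \<Rightarrow> ('x \<times> 'x) set" where
  "orbit_equiv G X \<phi> = local_equiv \<phi> (carrier G) (topspace X)"

definition turbulent_point ::
  "('g, 'm) monoid_scheme \<Rightarrow> 'g topology \<Rightarrow> 'x topology \<Rightarrow> ('g \<Rightarrow> 'x \<Rightarrow> 'x) \<Rightarrow> 'x \<Rightarrow> bool" where
  "turbulent_point G TG X \<phi> x \<longleftrightarrow>
     (\<forall>S H. openin X S \<and> x \<in> S \<and>
            H \<subseteq> carrier G \<and> (\<exists>V. openin TG V \<and> \<one>\<^bsub>G\<^esub> \<in> V \<and> V \<subseteq> H) \<longrightarrow>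
        somewhere_dense_in X (local_orbit \<phi> S H x))"

definition generically_turbulent ::
  "('g, 'm) monoid_scheme \<Rightarrow> 'g topology \<Rightarrow> 'x topology \<Rightarrow> ('g \<Rightarrow> 'x \<Rightarrow> 'x) \<Rightarrow> bool" where
  "generically_turbulent G TG X \<phi> \<longleftrightarrow>
     comeager_in X (\<Union>{Q \<in> orbits G (topspace X) \<phi>.
        dense_in X Q \<and> (\<forall>x\<in>Q. turbulent_point G TG X \<phi> x) \<and> meager_in X Q})"

definition hereditarily_generically_ergodic ::
  "('g, 'm) monoid_scheme \<Rightarrow> 'g topology \<Rightarrow> 'x topology \<Rightarrow> ('g \<Rightarrow> 'x \<Rightarrow> 'x) \<Rightarrow>
   'y topology \<Rightarrow> ('y \<times> 'y) set \<Rightarrow> bool" where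
  "hereditarily_generically_ergodic G TG X \<phi> Y F \<longleftrightarrow>
     (\<forall>S H. openin X S \<and> S \<noteq> {} \<and> openin TG H \<and> \<one>\<^bsub>G\<^esub> \<in> H \<and>
            comeager_in (subtopology X S)
              {x \<in> S. dense_in (subtopology X S) (local_orbit \<phi> S H x)} \<longrightarrow>
        generically_ergodic (subtopology X S) (local_equiv \<phi> H S) Y F)"


section \<open>Class 4\<close>

definition sum_rel :: "(nat \<Rightarrow> ('a \<times> 'a) set) \<Rightarrow> ((nat \<times> 'a) \<times> (nat \<times> 'a)) set" where
  "sum_rel F = {((k, x), (l, y)). k = l \<and> (x, y) \<in> F k}"

definition prod_rel :: "(nat \<Rightarrow> ('a \<times> 'a) set) \<Rightarrow> ((nat \<Rightarrow> 'a) \<times> (nat \<Rightarrow> 'a)) set" where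
  "prod_rel F = {(x, y). \<forall>k. (x k, y k) \<in> F k}"

definition Fubini_rel :: "(nat \<Rightarrow> ('a \<times> 'a) set) \<Rightarrow> ((nat \<Rightarrow> 'a) \<times> (nat \<Rightarrow> 'a)) set" where
  "Fubini_rel F = {(x, y). finite {k. (x k, y k) \<notin> F k}}"

definition power_rel :: "('a \<times> 'a) set \<Rightarrow> ((nat \<Rightarrow> 'a) \<times> (nat \<Rightarrow> 'a)) set" where
  "power_rel F = {(x, y). (\<forall>k. \<exists>l. (x k, y l) \<in> F) \<and> (\<forall>l. \<exists>k. (x k, y l) \<in> F)}"

definition pullback_rel :: "'a topology \<Rightarrow> ('a \<Rightarrow> 'b) \<Rightarrow> ('b \<times> 'b) set \<Rightarrow> ('a \<times> 'a) set" where
  "pullback_rel X h F = {(x, y). x \<in> topspace X \<and> y \<in> topspace X \<and> (h x, h y) \<in> F}"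

text \<open>
  Sums and products change the underlying type, so the least class cannot be defined by one
  polymorphic induction.  It is generated on spaces carried by subsets of the type of sets of
  naturals, which has the cardinality of the continuum, so that every Polish space is homeomorphic
  to such a space.  A sum or product is represented there by any homeomorphic copy of it; the
  predicate \<open>class4\<close> below then transfers the class to arbitrary types along homeomorphisms.
  The lemmas \<open>class4_eq\<close>, ..., \<open>class4_power\<close> state the closure conditions literally,
  on the genuine sum and product topologies over arbitrary types.
\<close>

inductive class4_coded :: "nat set topology \<Rightarrow> (nat set \<times> nat set) set \<Rightarrow> bool" where
  eq: "Polish_space X \<Longrightarrow> class4_coded X (Id_on (topspace X))"
| union: "(\<And>k::nat. class4_coded X (F k)) \<Longrightarrow> equiv (topspace X) (\<Union>k. F k) \<Longrightarrow>
    class4_coded X (\<Union>k. F k)"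
| inter: "(\<And>k::nat. class4_coded X (F k)) \<Longrightarrow> class4_coded X (\<Inter>k. F k)"
| dsum: "(\<And>k. class4_coded (Y k) (F k)) \<Longrightarrow> homeomorphic_map X (sum_topology Y UNIV) h \<Longrightarrow>
    class4_coded X (pullback_rel X h (sum_rel F))"
| prod: "(\<And>k. class4_coded (Y k) (F k)) \<Longrightarrow> homeomorphic_map X (product_topology Y UNIV) h \<Longrightarrow>
    class4_coded X (pullback_rel X h (prod_rel F))"
| Fubini: "(\<And>k. class4_coded (Y k) (F k)) \<Longrightarrow> homeomorphic_map X (product_topology Y UNIV) h \<Longrightarrow>
    class4_coded X (pullback_rel X h (Fubini_rel F))"
| power: "class4_coded Y F \<Longrightarrow> homeomorphic_map X (product_topology (\<lambda>_::nat. Y) UNIV) h \<Longrightarrow>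
    class4_coded X (pullback_rel X h (power_rel F))"

definition class4 :: "'y topology \<Rightarrow> ('y \<times> 'y) set \<Rightarrow> bool" where
  "class4 Y F \<longleftrightarrow>
     (\<exists>X E h. class4_coded X E \<and> homeomorphic_map Y X h \<and> F = pullback_rel Y h E)"


subsection \<open>Class 4 is closed under homeomorphisms and under the generating operations\<close>

lemma homeo_mem: "homeomorphic_map X Y h \<Longrightarrow> x \<in> topspace X \<Longrightarrow> h x \<in> topspace Y"
  using homeomorphic_imp_surjective_map by blast

lemma pullback_rel_comp:
  assumes "homeomorphic_map X Y h"
  shows "pullback_rel X h (pullback_rel Y k F) = pullback_rel X (k \<circ> h) F"
  using homeo_mem[OF assms] by (auto simp: pullback_rel_def)

lemma equiv_pullback_rel:
  assumes "homeomorphic_map X Y h" "equiv (topspace Y) F"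
  shows "equiv (topspace X) (pullback_rel X h F)"
proof (rule equivI)
  show "pullback_rel X h F \<subseteq> topspace X \<times> topspace X"
    by (auto simp: pullback_rel_def)
  show "refl_on (topspace X) (pullback_rel X h F)"
    using assms(2) homeo_mem[OF assms(1)]
    by (auto simp: equiv_def pullback_rel_def refl_on_def)
  show "sym (pullback_rel X h F)"
    using assms(2) by (auto simp: equiv_def pullback_rel_def sym_def)
  show "trans (pullback_rel X h F)"
    using assms(2) unfolding equiv_def pullback_rel_def trans_def by blast
qed

lemma pullback_rel_UN: "pullback_rel X h (\<Union>k. F k) = (\<Union>k. pullback_rel X h (F k))"
  by (auto simp: pullback_rel_def)

lemma pullback_rel_INT: "pullback_rel X h (\<Inter>k. F k) = (\<Inter>k. pullback_rel X h (F k))"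
  by (auto simp: pullback_rel_def)

lemma class4_coded_homeo:
  assumes "class4_coded Y F" "homeomorphic_map X Y h"
  shows "class4_coded X (pullback_rel X h F)"
  using assms
proof (induction arbitrary: X h rule: class4_coded.induct)
  case (eq Y)
  have "Polish_space X"
    using eq homeomorphic_completely_metrizable_space homeomorphic_separable_space
      homeomorphic_map_imp_homeomorphic_space unfolding Polish_space_def by blast
  moreover have "pullback_rel X h (Id_on (topspace Y)) = Id_on (topspace X)"
    using homeo_mem[OF eq(2)] eq(2)
    by (auto simp: pullback_rel_def homeomorphic_map_def inj_on_def)
  ultimately show ?case by (simp add: class4_coded.eq)
next
  case (union Y F)
  then show ?case
    using equiv_pullback_rel[OF union.prems union.hyps(2)]
    unfolding pullback_rel_UN by (intro class4_coded.union) auto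
next
  case (inter Y F)
  then show ?case unfolding pullback_rel_INT by (intro class4_coded.inter) auto
next
  case (dsum Y F X' h')
  then show ?case
    by (simp add: pullback_rel_comp)
      (rule class4_coded.dsum[where Y = Y], auto intro: homeomorphic_map_compose)
next
  case (prod Y F X' h')
  then show ?case
    by (simp add: pullback_rel_comp)
      (rule class4_coded.prod[where Y = Y], auto intro: homeomorphic_map_compose)
next
  case (Fubini Y F X' h')
  then show ?case
    by (simp add: pullback_rel_comp)
      (rule class4_coded.Fubini[where Y = Y], auto intro: homeomorphic_map_compose)
next
  case (power Y F X' h')
  then show ?case
    by (simp add: pullback_rel_comp)
      (rule class4_coded.power[where Y = Y], auto intro: homeomorphic_map_compose)
qed

lemma class4_homeo:
  assumes "class4 Y F" "homeomorphic_map X Y h"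
  shows "class4 X (pullback_rel X h F)"
  using assms unfolding class4_def
  by (metis homeomorphic_map_compose pullback_rel_comp)

lemma homeomorphic_copy:
  assumes "inj_on f (topspace Y)"
  obtains X h where "homeomorphic_map X Y h" "homeomorphic_map Y X f"
proof -
  let ?g = "inv_into (topspace Y) f"
  let ?X = "pullback_topology (f ` topspace Y) ?g Y"
  have top: "topspace ?X = f ` topspace Y"
    using assms by (auto simp: topspace_pullback_topology inv_into_into)
  have "continuous_map ?X Y (id \<circ> ?g)"
    by (rule continuous_map_pullback) simp
  moreover have "continuous_map Y ?X f"
    by (rule continuous_map_pullback')
      (auto intro!: continuous_map_eq[OF continuous_map_id] simp: assms)
  ultimately have "homeomorphic_maps Y ?X f ?g"
    using assms unfolding homeomorphic_maps_def top by (auto simp: f_inv_into_f)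
  then show thesis using that homeomorphic_maps_map by blast
qed

lemma class4_codedI:
  assumes "homeomorphic_map Y X h" "class4_coded X (pullback_rel X k F)"
    "\<And>y. y \<in> topspace Y \<Longrightarrow> k (h y) = f y"
  shows "class4 Y (pullback_rel Y f F)"
proof -
  have "pullback_rel Y f F = pullback_rel Y h (pullback_rel X k F)"
    using assms(3) homeo_mem[OF assms(1)] by (auto simp: pullback_rel_def)
  then show ?thesis using assms class4_def by blast
qed

lemma class4_via:
  fixes Z :: "'z topology" and c :: "'z \<Rightarrow> nat set"
  assumes f: "homeomorphic_map Y Z f" and c: "inj c"
    and Z: "\<And>X h. homeomorphic_map X Z h \<Longrightarrow> class4_coded X (pullback_rel X h E)"
  shows "class4 Y (pullback_rel Y f E)"
proof -
  obtain X and h where h: "homeomorphic_map X Z h" and "homeomorphic_map Z X c"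
    using homeomorphic_copy c inj_on_subset by (metis subset_UNIV)
  then obtain h' where h': "homeomorphic_maps X Z h h'"
    using homeomorphic_map_maps by blast
  then have "homeomorphic_map Z X h'" using homeomorphic_maps_map by blast
  then have "homeomorphic_map Y X (h' \<circ> f)" using f homeomorphic_map_compose by blast
  then show ?thesis
    by (rule class4_codedI[OF _ Z[OF h]])
      (use h' homeo_mem[OF f] in \<open>auto simp: homeomorphic_maps_def\<close>)
qed

lemma Polish_space_inj:
  assumes "Polish_space (Y :: 'y topology)"
  obtains f :: "'y \<Rightarrow> nat set" where "inj_on f (topspace Y)"
proof -
  obtain M d where "Metric_space M d" and Y: "Y = Metric_space.mtopology M d"
    using assms unfolding Polish_space_def completely_metrizable_space_def by blast
  then interpret Metric_space M d by blast
  obtain C where C: "countable C" "C \<subseteq> M" "mtopology closure_of C = M"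
    using assms unfolding Polish_space_def separable_space_def Y by auto
  let ?f = "\<lambda>x. prod_encode ` {(to_nat_on C c, n) |c n. c \<in> C \<and> d c x < inverse (real (Suc n))}"
  have "inj_on ?f (topspace Y)"
  proof (rule inj_onI, rule ccontr)
    fix x y assume "x \<in> topspace Y" "y \<in> topspace Y" and eq: "?f x = ?f y" and ne: "x \<noteq> y"
    then have xy: "x \<in> M" "y \<in> M" unfolding Y by auto
    then have "d x y / 2 > 0" using ne by simp
    then obtain n where n: "inverse (real (Suc n)) < d x y / 2"
      using reals_Archimedean by blast
    have "x \<in> mtopology closure_of C" using C(3) xy by simp
    then obtain c where c: "c \<in> C" "d x c < inverse (real (Suc n))"
      unfolding metric_closure_of by (auto simp del: of_nat_Suc dest!: spec[of _ "inverse (real (Suc n))"])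
    then have "prod_encode (to_nat_on C c, n) \<in> ?f x"
      by (auto simp: commute simp del: of_nat_Suc)
    then have "prod_encode (to_nat_on C c, n) \<in> ?f y" using eq by simp
    then obtain c' where "c' \<in> C" "to_nat_on C c' = to_nat_on C c" "d c' y < inverse (real (Suc n))"
      by (auto simp del: of_nat_Suc)
    then have "d c y < inverse (real (Suc n))"
      using c(1) C(1) by (simp del: of_nat_Suc)
    moreover have "d x y \<le> d x c + d c y"
      using triangle xy c(1) C(2) by blast
    ultimately show False using c(2) n by linarith
  qed
  then show thesis using that by blast
qed

lemma class4_eq:
  assumes "Polish_space Y" shows "class4 Y (Id_on (topspace Y))"
proof -
  obtain f :: "'a \<Rightarrow> nat set" where "inj_on f (topspace Y)"
    using Polish_space_inj assms by blast
  then obtain X where X: "homeomorphic_map Y X f"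
    using homeomorphic_copy by metis
  then have "Polish_space X"
    using assms homeomorphic_completely_metrizable_space homeomorphic_separable_space
      homeomorphic_map_imp_homeomorphic_space unfolding Polish_space_def by blast
  moreover have "pullback_rel Y f (Id_on (topspace X)) = Id_on (topspace Y)"
    using homeo_mem[OF X] X by (auto simp: pullback_rel_def homeomorphic_map_def inj_on_def)
  ultimately show ?thesis
    unfolding class4_def using X class4_coded.eq by metis
qed

lemma class4_common_code:
  assumes "\<And>k::nat. class4 Y (F k)"
  obtains X h E where "homeomorphic_map Y X h" "\<And>k. class4_coded X (E k)"
    "\<And>k. F k = pullback_rel Y h (E k)"
proof -
  from assms have "\<forall>k. \<exists>X E h. class4_coded X E \<and> homeomorphic_map Y X h \<and> F k = pullback_rel Y h E"
    unfolding class4_def by blast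
  then obtain X E h where *: "\<And>k. class4_coded (X k) (E k)" "\<And>k. homeomorphic_map Y (X k) (h k)"
    "\<And>k. F k = pullback_rel Y (h k) (E k)" by metis
  obtain g where g: "homeomorphic_maps Y (X 0) (h 0) g"
    using * homeomorphic_map_maps by blast
  have gm: "homeomorphic_map (X 0) Y g" using g homeomorphic_maps_map by blast
  show thesis
  proof (rule that[of "X 0" "h 0" "\<lambda>k. pullback_rel (X 0) (h k \<circ> g) (E k)"])
    show "homeomorphic_map Y (X 0) (h 0)" by (rule *)
    show "class4_coded (X 0) (pullback_rel (X 0) (h k \<circ> g) (E k))" for k
      using class4_coded_homeo *(1,2) gm homeomorphic_map_compose by blast
    show "F k = pullback_rel Y (h 0) (pullback_rel (X 0) (h k \<circ> g) (E k))" for k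
      using g homeo_mem[OF *(2)[of 0]] unfolding *(3)
      by (auto simp: pullback_rel_def homeomorphic_maps_def)
  qed
qed

lemma class4_union:
  assumes "\<And>k::nat. class4 Y (F k)" "equiv (topspace Y) (\<Union>k. F k)"
  shows "class4 Y (\<Union>k. F k)"
proof -
  obtain X h E where *: "homeomorphic_map Y X h" "\<And>k. class4_coded X (E k)"
    "\<And>k. F k = pullback_rel Y h (E k)"
    using class4_common_code assms(1) by blast
  obtain g where g: "homeomorphic_maps Y X h g"
    using * homeomorphic_map_maps by blast
  have gm: "homeomorphic_map X Y g" using g homeomorphic_maps_map by blast
  have E: "class4_coded X (pullback_rel X g (F k))" for k
    using class4_coded_homeo[OF *(2)] homeomorphic_map_compose[OF gm *(1)]
    unfolding *(3) pullback_rel_comp[OF gm] by blast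
  have "class4_coded X (\<Union>k. pullback_rel X g (F k))"
    using E equiv_pullback_rel[OF gm assms(2)]
    unfolding pullback_rel_UN by (rule class4_coded.union)
  moreover have "(\<Union>k. F k) = pullback_rel Y h (\<Union>k. pullback_rel X g (F k))"
    using g homeo_mem[OF *(1)] unfolding *(3)
    by (auto simp: pullback_rel_def homeomorphic_maps_def)
  ultimately show ?thesis unfolding class4_def using *(1) by blast
qed

lemma class4_inter:
  assumes "\<And>k::nat. class4 Y (F k)" shows "class4 Y (\<Inter>k. F k)"
proof -
  obtain X h E where *: "homeomorphic_map Y X h" "\<And>k. class4_coded X (E k)"
    "\<And>k. F k = pullback_rel Y h (E k)"
    using class4_common_code assms(1) by blast
  have "(\<Inter>k. F k) = pullback_rel Y h (\<Inter>k. E k)"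
    unfolding *(3) pullback_rel_INT ..
  then show ?thesis
    unfolding class4_def using class4_coded.inter[of X E, OF *(2)] *(1) by blast
qed

lemma class4_codes:
  assumes "\<And>k::nat. class4 (Y k) (F k)"
  obtains X h E where "\<And>k. homeomorphic_map (Y k) (X k) (h k)" "\<And>k. class4_coded (X k) (E k)"
    "\<And>k. F k = pullback_rel (Y k) (h k) (E k)"
  using assms unfolding class4_def by metis

lemma continuous_map_sum:
  assumes "\<And>k. continuous_map (X k) (Y k) (h k)"
  shows "continuous_map (sum_topology X UNIV) (sum_topology Y UNIV) (\<lambda>(k, x). (k, h k x))"
  unfolding continuous_map_def
proof (intro conjI allI impI)
  show "(\<lambda>(k, x). (k, h k x)) \<in> topspace (sum_topology X UNIV) \<rightarrow> topspace (sum_topology Y UNIV)"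
    using assms by (auto simp: continuous_map_def Pi_iff)
next
  fix U assume U: "openin (sum_topology Y UNIV) U"
  have "openin (X k) {x \<in> topspace (X k). h k x \<in> {y. (k, y) \<in> U}}" for k
    using U assms[of k] unfolding openin_sum_topology continuous_map_def by blast
  moreover have "{x. (k, x) \<in> {x \<in> topspace (sum_topology X UNIV). (case x of (k, x) \<Rightarrow> (k, h k x)) \<in> U}}
      = {x \<in> topspace (X k). h k x \<in> {y. (k, y) \<in> U}}" for k
    by auto
  ultimately show "openin (sum_topology X UNIV)
      {x \<in> topspace (sum_topology X UNIV). (case x of (k, x) \<Rightarrow> (k, h k x)) \<in> U}"
    unfolding openin_sum_topology by auto
qed

lemma homeomorphic_map_sum:
  assumes "\<And>k. homeomorphic_map (X k) (Y k) (h k)"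
  shows "homeomorphic_map (sum_topology X UNIV) (sum_topology Y UNIV) (\<lambda>(k, x). (k, h k x))"
proof -
  obtain g where g: "\<And>k. homeomorphic_maps (X k) (Y k) (h k) (g k)"
    using assms unfolding homeomorphic_map_maps by metis
  have "homeomorphic_maps (sum_topology X UNIV) (sum_topology Y UNIV)
      (\<lambda>(k, x). (k, h k x)) (\<lambda>(k, x). (k, g k x))"
    using g unfolding homeomorphic_maps_def by (auto intro!: continuous_map_sum)
  then show ?thesis using homeomorphic_maps_map by blast
qed

lemma continuous_map_product:
  assumes "\<And>k. continuous_map (X k) (Y k) (h k)"
  shows "continuous_map (product_topology X UNIV) (product_topology Y UNIV) (\<lambda>x k. h k (x k))"
  unfolding continuous_map_componentwise_UNIV
proof
  fix k
  have "continuous_map (product_topology X UNIV) (Y k) (h k \<circ> (\<lambda>x. x k))"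
    by (rule continuous_map_compose[OF _ assms]) (rule continuous_map_product_projection, simp)
  then show "continuous_map (product_topology X UNIV) (Y k) (\<lambda>x. h k (x k))"
    by (simp add: o_def)
qed

lemma homeomorphic_map_product:
  assumes "\<And>k. homeomorphic_map (X k) (Y k) (h k)"
  shows "homeomorphic_map (product_topology X UNIV) (product_topology Y UNIV) (\<lambda>x k. h k (x k))"
proof -
  obtain g where g: "\<And>k. homeomorphic_maps (X k) (Y k) (h k) (g k)"
    using assms unfolding homeomorphic_map_maps by metis
  have "homeomorphic_maps (product_topology X UNIV) (product_topology Y UNIV)
      (\<lambda>x k. h k (x k)) (\<lambda>x k. g k (x k))"
    using g unfolding homeomorphic_maps_def
    by (auto intro!: continuous_map_product simp: PiE_iff fun_eq_iff)
  then show ?thesis using homeomorphic_maps_map by blast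
qed

lemma inj_code_pair: "inj (\<lambda>(k::nat, A::nat set). sum_encode ` insert (Inl k) (Inr ` A))"
proof (rule injI, clarify)
  fix k l :: nat and A B :: "nat set"
  assume "sum_encode ` insert (Inl k) (Inr ` A) = sum_encode ` insert (Inl l) (Inr ` B)"
  then have *: "insert (Inl k) (Inr ` A) = insert (Inl l) (Inr ` B)"
    using inj_sum_encode[of UNIV] by (simp only: inj_image_eq_iff)
  then have "k = l" by blast
  moreover have "A = B" using * by blast
  ultimately show "k = l \<and> A = B" by blast
qed

lemma inj_code_seq: "inj (\<lambda>f :: nat \<Rightarrow> nat set. prod_encode ` Sigma UNIV f)"
proof (rule injI)
  fix f g :: "nat \<Rightarrow> nat set"
  assume "prod_encode ` Sigma UNIV f = prod_encode ` Sigma UNIV g"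
  then have "Sigma UNIV f = Sigma UNIV g"
    using inj_prod_encode[of UNIV] by (simp only: inj_image_eq_iff)
  then show "f = g" by blast
qed

lemma class4_dsum:
  assumes "\<And>k. class4 (Y k) (F k)"
  shows "class4 (sum_topology Y UNIV) (sum_rel F)"
proof -
  obtain X h E where *: "\<And>k. homeomorphic_map (Y k) (X k) (h k)" "\<And>k. class4_coded (X k) (E k)"
    "\<And>k. F k = pullback_rel (Y k) (h k) (E k)"
    using class4_codes assms by blast
  have "sum_rel F = pullback_rel (sum_topology Y UNIV) (\<lambda>(k, x). (k, h k x)) (sum_rel E)"
    unfolding *(3) by (auto simp: sum_rel_def pullback_rel_def)
  then show ?thesis
    using class4_via[OF homeomorphic_map_sum[OF *(1)] inj_code_pair class4_coded.dsum[OF *(2)]]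
    by simp
qed

lemma class4_prod:
  assumes "\<And>k. class4 (Y k) (F k)"
  shows "class4 (product_topology Y UNIV) (prod_rel F)"
proof -
  obtain X h E where *: "\<And>k. homeomorphic_map (Y k) (X k) (h k)" "\<And>k. class4_coded (X k) (E k)"
    "\<And>k. F k = pullback_rel (Y k) (h k) (E k)"
    using class4_codes assms by blast
  have "prod_rel F = pullback_rel (product_topology Y UNIV) (\<lambda>x k. h k (x k)) (prod_rel E)"
    unfolding *(3) by (auto simp: prod_rel_def pullback_rel_def PiE_iff)
  then show ?thesis
    using class4_via[OF homeomorphic_map_product[OF *(1)] inj_code_seq class4_coded.prod[OF *(2)]]
    by simp
qed

lemma class4_Fubini:
  assumes "\<And>k. class4 (Y k) (F k)"
  shows "class4 (product_topology Y UNIV)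
    (Fubini_rel F \<inter> topspace (product_topology Y UNIV) \<times> topspace (product_topology Y UNIV))"
proof -
  obtain X h E where *: "\<And>k. homeomorphic_map (Y k) (X k) (h k)" "\<And>k. class4_coded (X k) (E k)"
    "\<And>k. F k = pullback_rel (Y k) (h k) (E k)"
    using class4_codes assms by blast
  have "Fubini_rel F \<inter> topspace (product_topology Y UNIV) \<times> topspace (product_topology Y UNIV)
      = pullback_rel (product_topology Y UNIV) (\<lambda>x k. h k (x k)) (Fubini_rel E)"
    unfolding *(3) by (auto simp: Fubini_rel_def pullback_rel_def PiE_iff)
  then show ?thesis
    using class4_via[OF homeomorphic_map_product[OF *(1)] inj_code_seq class4_coded.Fubini[OF *(2)]]
    by simp
qed

lemma class4_power:
  assumes "class4 Y F"
  shows "class4 (product_topology (\<lambda>_::nat. Y) UNIV) (power_rel F)"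
proof -
  obtain X h E where *: "homeomorphic_map Y X h" "class4_coded X E" "F = pullback_rel Y h E"
    using assms unfolding class4_def by blast
  have "power_rel F
      = pullback_rel (product_topology (\<lambda>_::nat. Y) UNIV) (\<lambda>x k. h (x k)) (power_rel E)"
    unfolding *(3) by (auto simp: power_rel_def pullback_rel_def PiE_iff)
  then show ?thesis
    using class4_via[OF homeomorphic_map_product[OF *(1)] inj_code_seq class4_coded.power[OF *(2)]]
    by simp
qed

end

theory Submission
  imports Defs
begin

text \<open>
  Call a relation ergodic if every Baire measurable map that is invariant under a local action with
  generically dense local orbits is generically constant modulo the relation; it suffices that the
  invariance holds on a comeager set, and this weaker hypothesis makes the property inductive along
  Class 4.  For equality it is the topological zero-one law for generically invariant sets.
  Countable intersections and products are immediate, sums follow from the zero-one law, and the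
  Fubini product is a countable union of products.  In the remaining cases, union and countable power,
  invariance gives \<open>(\<alpha> x, \<beta> l (\<phi> g x)) \<in> R l\<close> with \<open>l\<close> depending on \<open>(g, x)\<close>.  Baire category
  fixes \<open>l\<close> on a box of pairs; comparing two pairs with the same image \<open>\<phi> g x\<close> shows that \<open>\<alpha>\<close> is
  generically invariant modulo \<open>R l\<close> for a smaller local action, whose local orbits turbulence makes
  dense after shrinking the open set.  Hence \<open>\<alpha>\<close> is constant modulo \<open>R l\<close> on some open set, and the
  zero-one law spreads this out.  If a reduction of the orbit equivalence relation existed, being
  generically constant it would confine a comeager set to one meager orbit.
\<close>

section \<open>Meager sets and the Baire property\<close>

text \<open>Invariance on a comeager set alone is forced by the category step: fixing
  \<open>l\<close> on a box of pairs controls \<open>\<alpha>\<close> off a meager set of points,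
  and that set need not be invariant, so the induction hypothesis for \<open>R l\<close> must
  tolerate it. The zero-one law copes by replacing an almost invariant set \<open>W\<close> with the
  open set of points near which \<open>W\<close> is comeager, which is invariant exactly. The
  induction must also range over all pairs \<open>(S, H)\<close>, since the box dictates its own
  neighbourhood of the identity and turbulence then its own open set. Two maps
  \<open>\<alpha>\<close> and \<open>\<beta> l\<close> occur because the countable power compares
  coordinate \<open>k\<close> at one point with coordinate \<open>l\<close> at another; the union
  takes both equal to \<open>\<theta>\<close>. Measurability of a relation is carried along on
  \<open>X\<close> and also on \<open>prod_topology TG X\<close>, where the sets of pairs with a
  fixed \<open>l\<close> live. The return from pairs to points uses that a meager set in the product
  has meager sections over generic points.\<close>

lemma nowhere_dense_in_subset:
  assumes "nowhere_dense_in X S" "T \<subseteq> S"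
  shows "nowhere_dense_in X T"
  using assms closure_of_mono[OF assms(2), of X] interior_of_mono
  unfolding nowhere_dense_in_def by (metis bot.extremum_uniqueI order_trans)

text \<open>Closure-free form of nowhere density: it can be transported along open maps and tested
  on boxes, where closures are awkward.\<close>

lemma nowhere_dense_in_disjoint_iff:
  "nowhere_dense_in X S \<longleftrightarrow>
    S \<subseteq> topspace X \<and> (\<forall>U. openin X U \<and> U \<noteq> {} \<longrightarrow> (\<exists>V. openin X V \<and> V \<noteq> {} \<and> V \<subseteq> U \<and> V \<inter> S = {}))"
  (is "_ \<longleftrightarrow> _ \<and> ?R")
proof -
  have "X interior_of (X closure_of S) = {} \<longleftrightarrow> ?R" if S: "S \<subseteq> topspace X"
  proof
    assume L: "X interior_of (X closure_of S) = {}"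
    show ?R
    proof (intro allI impI, elim conjE)
      fix U assume U: "openin X U" "U \<noteq> {}"
      then have "\<not> U \<subseteq> X closure_of S"
        using L interior_of_maximal by fastforce
      then show "\<exists>V. openin X V \<and> V \<noteq> {} \<and> V \<subseteq> U \<and> V \<inter> S = {}"
        using U closure_of_subset[OF S]
        by (intro exI[of _ "U - X closure_of S"]) (auto intro: openin_diff)
    qed
  next
    assume R: ?R
    show "X interior_of (X closure_of S) = {}"
    proof (rule ccontr)
      assume "X interior_of (X closure_of S) \<noteq> {}"
      then obtain V where V: "openin X V" "V \<noteq> {}" "V \<subseteq> X interior_of (X closure_of S)" "V \<inter> S = {}"
        using R[rule_format, of "X interior_of (X closure_of S)"] by auto
      then show False
        using openin_Int_closure_of_eq_empty[OF V(1), of S] interior_of_subset[of X "X closure_of S"] by auto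
    qed
  qed
  then show ?thesis unfolding nowhere_dense_in_def by blast
qed

lemma meager_in_subset: "meager_in X S \<Longrightarrow> T \<subseteq> S \<Longrightarrow> meager_in X T"
  unfolding meager_in_def by blast

lemma meager_in_subset_topspace: "meager_in X S \<Longrightarrow> S \<subseteq> topspace X"
  unfolding meager_in_def nowhere_dense_in_def by blast

lemma nowhere_dense_imp_meager: "nowhere_dense_in X S \<Longrightarrow> meager_in X S"
  unfolding meager_in_def by (intro exI[of _ "\<lambda>_. S"]) auto

lemma meager_in_empty [simp]: "meager_in X {}"
  by (intro nowhere_dense_imp_meager) (auto simp: nowhere_dense_in_def)

lemma meager_in_UN_nat:
  assumes "\<And>n::nat. meager_in X (A n)"
  shows "meager_in X (\<Union>n. A n)"
proof -
  obtain N where N: "\<And>n k. nowhere_dense_in X (N n k)" "\<And>n. A n \<subseteq> (\<Union>k. N n (k::nat))"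
    using assms unfolding meager_in_def by metis
  have "(\<Union>n. A n) \<subseteq> (\<Union>m. case_prod N (prod_decode m))"
  proof
    fix x assume "x \<in> (\<Union>n. A n)"
    then obtain n k where "x \<in> N n k" using N(2) by blast
    then show "x \<in> (\<Union>m. case_prod N (prod_decode m))"
      by (intro UN_I[of "prod_encode (n, k)"]) auto
  qed
  moreover have "nowhere_dense_in X (case_prod N (prod_decode m))" for m
    by (simp add: N case_prod_beta)
  ultimately show ?thesis
    unfolding meager_in_def by (intro exI[of _ "\<lambda>m. case_prod N (prod_decode m)"] conjI allI)
qed

lemma meager_in_UN:
  assumes "countable I" "\<And>i. i \<in> I \<Longrightarrow> meager_in X (A i)"
  shows "meager_in X (\<Union>i\<in>I. A i)"
proof (cases "I = {}")
  case False
  then have "(\<Union>i\<in>I. A i) = \<Union>(A ` range (from_nat_into I))"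
    using range_from_nat_into[OF False assms(1)] by simp
  also have "\<dots> = (\<Union>n. A (from_nat_into I n))"
    by (simp only: image_image)
  finally have "(\<Union>i\<in>I. A i) = (\<Union>n. A (from_nat_into I n))" .
  then show ?thesis
    using meager_in_UN_nat[of X "\<lambda>n. A (from_nat_into I n)"] assms(2) from_nat_into[OF False] by simp
qed simp

lemma meager_in_Un: "meager_in X A \<Longrightarrow> meager_in X B \<Longrightarrow> meager_in X (A \<union> B)"
  using meager_in_UN[of "{A, B}" X "\<lambda>x. x"] by auto

lemma not_meager_open:
  assumes "completely_metrizable_space X" "openin X U" "U \<noteq> {}"
  shows "\<not> meager_in X U"
proof
  assume "meager_in X U"
  then obtain N where N: "\<And>n. nowhere_dense_in X (N n)" "U \<subseteq> (\<Union>n. N (n::nat))"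
    unfolding meager_in_def by blast
  have "X interior_of (\<Union>(range (\<lambda>n. X closure_of N n))) = {}"
    using N(1) by (intro Baire_category_alt) (auto simp: assms(1) nowhere_dense_in_def)
  moreover have "U \<subseteq> (\<Union>(range (\<lambda>n. X closure_of N n)))"
    using N(2) closure_of_subset[of "N _" X] N(1) unfolding nowhere_dense_in_def
    by (meson SUP_mono' order_trans)
  ultimately show False
    using assms interior_of_maximal by fastforce
qed

lemma nowhere_dense_in_frontier:
  assumes "openin X U" shows "nowhere_dense_in X (X closure_of U - U)"
  unfolding nowhere_dense_in_disjoint_iff
proof (intro conjI allI impI)
  show "X closure_of U - U \<subseteq> topspace X"
    using closure_of_subset_topspace[of X U] by blast
  fix V assume V: "openin X V \<and> V \<noteq> {}"
  show "\<exists>W. openin X W \<and> W \<noteq> {} \<and> W \<subseteq> V \<and> W \<inter> (X closure_of U - U) = {}"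
  proof (cases "V \<inter> U = {}")
    case True
    then have "V \<inter> X closure_of U = {}"
      using V openin_Int_closure_of_eq_empty by metis
    then show ?thesis using V by (intro exI[of _ V]) auto
  next
    case False
    then show ?thesis using V assms by (intro exI[of _ "V \<inter> U"]) blast
  qed
qed

section \<open>The sigma-algebra of sets with the Baire property\<close>

lemma Baire_property_openin: "openin X U \<Longrightarrow> Baire_property_in X U"
  unfolding Baire_property_in_def using openin_subset by force

lemma sigma_algebra_Baire_property:
  "sigma_algebra (topspace X) {A. Baire_property_in X A}"
  unfolding sigma_algebra_iff2
proof (intro conjI ballI allI impI)
  show "{A. Baire_property_in X A} \<subseteq> Pow (topspace X)"
    by (auto simp: Baire_property_in_def)
  show "{} \<in> {A. Baire_property_in X A}"
    by (simp add: Baire_property_openin)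
next
  fix A assume "A \<in> {A. Baire_property_in X A}"
  then obtain U where A: "A \<subseteq> topspace X" "openin X U" "meager_in X ((A - U) \<union> (U - A))"
    by (auto simp: Baire_property_in_def)
  \<comment> \<open>The complement of \<open>U\<close> is closed, so its interior is taken instead;
    the error lies in \<open>X closure_of U - U\<close>, which is nowhere dense.\<close>
  let ?V = "topspace X - X closure_of U"
  have "meager_in X (((A - U) \<union> (U - A)) \<union> (X closure_of U - U))"
    using A nowhere_dense_in_frontier nowhere_dense_imp_meager meager_in_Un by blast
  then have "meager_in X (((topspace X - A) - ?V) \<union> (?V - (topspace X - A)))"
    by (rule meager_in_subset) (use A closure_of_subset[of U X] openin_subset in auto)
  then show "topspace X - A \<in> {A. Baire_property_in X A}"
    unfolding Baire_property_in_def mem_Collect_eq by (intro conjI exI[of _ ?V]) (auto intro: openin_diff)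
next
  fix A :: "nat \<Rightarrow> 'a set" assume "range A \<subseteq> {A. Baire_property_in X A}"
  then obtain U where U: "\<And>n. openin X (U n)" "\<And>n. meager_in X ((A n - U n) \<union> (U n - A n))"
    "\<And>n. A n \<subseteq> topspace X"
    unfolding Baire_property_in_def by (auto simp: image_subset_iff) metis
  have "meager_in X (((\<Union>n. A n) - (\<Union>n. U n)) \<union> ((\<Union>n. U n) - (\<Union>n. A n)))"
    by (rule meager_in_subset[OF meager_in_UN_nat[of X "\<lambda>n. (A n - U n) \<union> (U n - A n)", OF U(2)]]) blast
  then show "(\<Union>n. A n) \<in> {A. Baire_property_in X A}"
    using U unfolding Baire_property_in_def mem_Collect_eq by (intro conjI exI[of _ "\<Union>n. U n"]) auto
qed

interpretation Baire_property: sigma_algebra "topspace X" "{A. Baire_property_in X A}" for X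
  by (rule sigma_algebra_Baire_property)

lemma Baire_property_Int: "Baire_property_in X A \<Longrightarrow> Baire_property_in X B \<Longrightarrow> Baire_property_in X (A \<inter> B)"
  using Baire_property.Int[of A X B] by simp

lemma Baire_property_Diff: "Baire_property_in X A \<Longrightarrow> Baire_property_in X B \<Longrightarrow> Baire_property_in X (A - B)"
  using Baire_property.Diff[of A X B] by simp

lemma Baire_property_meager: "meager_in X A \<Longrightarrow> Baire_property_in X A"
  unfolding Baire_property_in_def using meager_in_subset_topspace by (intro conjI exI[of _ "{}"]) auto

text \<open>The open set equal to \<open>A\<close> modulo meager sets must meet \<open>S\<close>,
  since otherwise \<open>A\<close> would lie in the meager difference. This is how largeness in
  category becomes an actual open set or box.\<close>

lemma Baire_property_nonmeager:
  assumes "Baire_property_in X A" "\<not> meager_in X A" "A \<subseteq> S" "openin X S"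
  obtains U where "openin X U" "U \<noteq> {}" "U \<subseteq> S" "meager_in X (U - A)"
proof -
  obtain U where U: "openin X U" "meager_in X ((A - U) \<union> (U - A))"
    using assms unfolding Baire_property_in_def by blast
  have "U \<inter> S \<noteq> {}"
    using assms(2,3) meager_in_subset[OF U(2), of A] by blast
  moreover have "meager_in X (U \<inter> S - A)"
    by (rule meager_in_subset[OF U(2)]) blast
  ultimately show thesis
    using that[of "U \<inter> S"] U assms by blast
qed

text \<open>The image of \<open>U\<close> is open because \<open>f\<close> is open, so
  \<open>N\<close> can be avoided on an open part of it, and continuity pulls that part back into
  \<open>U\<close>. Applied to translations of the group and of the space, to the projection
  \<open>snd\<close> and to the action map.\<close>

lemma nowhere_dense_in_vimage:
  assumes "continuous_map Z X f" "open_map Z X f" "nowhere_dense_in X N"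
  shows "nowhere_dense_in Z {z \<in> topspace Z. f z \<in> N}"
  unfolding nowhere_dense_in_disjoint_iff
proof (intro conjI allI impI)
  fix U assume U: "openin Z U \<and> U \<noteq> {}"
  then obtain V where V: "openin X V" "V \<noteq> {}" "V \<subseteq> f ` U" "V \<inter> N = {}"
    using assms(2,3) unfolding open_map_def nowhere_dense_in_disjoint_iff by (meson image_is_empty)
  have "openin Z {z \<in> topspace Z. f z \<in> V}"
    using assms(1) V(1) by (simp add: continuous_map_def)
  then have "openin Z (U \<inter> {z \<in> topspace Z. f z \<in> V})" using U by blast
  moreover have "U \<inter> {z \<in> topspace Z. f z \<in> V} \<noteq> {}"
    using V(2,3) U openin_subset by fast
  ultimately show "\<exists>V. openin Z V \<and> V \<noteq> {} \<and> V \<subseteq> U \<and> V \<inter> {z \<in> topspace Z. f z \<in> N} = {}"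
    using V(4) by (intro exI[of _ "U \<inter> {z \<in> topspace Z. f z \<in> V}"]) auto
qed auto

lemma meager_in_vimage:
  assumes "continuous_map Z X f" "open_map Z X f" "meager_in X N"
  shows "meager_in Z {z \<in> topspace Z. f z \<in> N}"
proof -
  obtain M where M: "\<And>n. nowhere_dense_in X (M n)" "N \<subseteq> (\<Union>n. M (n::nat))"
    using assms(3) unfolding meager_in_def by blast
  show ?thesis
    unfolding meager_in_def
    using nowhere_dense_in_vimage[OF assms(1,2) M(1)] M(2)
    by (intro exI[of _ "\<lambda>n. {z \<in> topspace Z. f z \<in> M n}"]) blast
qed

lemma Baire_property_vimage:
  assumes "continuous_map Z X f" "open_map Z X f" "Baire_property_in X A"
  shows "Baire_property_in Z {z \<in> topspace Z. f z \<in> A}"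
proof -
  obtain U where U: "openin X U" "meager_in X ((A - U) \<union> (U - A))"
    using assms unfolding Baire_property_in_def by blast
  have "openin Z {z \<in> topspace Z. f z \<in> U}"
    using assms(1) U(1) by (simp add: continuous_map_def)
  moreover have "meager_in Z (({z \<in> topspace Z. f z \<in> A} - {z \<in> topspace Z. f z \<in> U})
     \<union> ({z \<in> topspace Z. f z \<in> U} - {z \<in> topspace Z. f z \<in> A}))"
    by (rule meager_in_subset[OF meager_in_vimage[OF assms(1,2) U(2)]]) blast
  ultimately show ?thesis unfolding Baire_property_in_def by blast
qed

lemma second_countable_Polish_space:
  assumes "Polish_space X" shows "second_countable X"
proof -
  obtain M d where "Metric_space M d" and X: "X = Metric_space.mtopology M d"
    using assms unfolding Polish_space_def completely_metrizable_space_def by blast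
  then interpret Metric_space M d by blast
  obtain C where C: "countable C" "C \<subseteq> M" "mtopology closure_of C = M"
    using assms unfolding Polish_space_def separable_space_def X by auto
  let ?B = "(\<lambda>(c, n). mball c (inverse (real (Suc n)))) ` (C \<times> UNIV)"
  show ?thesis
    unfolding second_countable_def X
  proof (intro exI[of _ ?B] conjI ballI allI impI)
    show "countable ?B" using C by blast
    show "\<And>V. V \<in> ?B \<Longrightarrow> openin mtopology V" by auto
    fix U x assume "openin mtopology U \<and> x \<in> U"
    then obtain r where r: "r > 0" "mball x r \<subseteq> U" "x \<in> M"
      unfolding openin_mtopology by blast
    then obtain n where n: "inverse (real (Suc n)) < r / 2"
      using reals_Archimedean[of "r / 2"] by auto
    have "x \<in> mtopology closure_of C" using C(3) r by simp
    then obtain c where c: "c \<in> C" "d x c < inverse (real (Suc n))"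
      unfolding metric_closure_of
      by (auto simp del: of_nat_Suc dest!: spec[of _ "inverse (real (Suc n))"])
    have "mball c (inverse (real (Suc n))) \<subseteq> mball x r"
    proof
      fix y assume "y \<in> mball c (inverse (real (Suc n)))"
      then have y: "y \<in> M" "c \<in> M" "d c y < inverse (real (Suc n))" by auto
      have "d x y \<le> d x c + d c y" using triangle y r by blast
      then show "y \<in> mball x r" using y r c n by (simp del: of_nat_Suc)
    qed
    moreover have "x \<in> mball c (inverse (real (Suc n)))"
      using c C r by (auto simp: commute simp del: of_nat_Suc)
    ultimately show "\<exists>V\<in>?B. x \<in> V \<and> V \<subseteq> U" using c r by blast
  qed
qed

text \<open>The easy half of the Kuratowski--Ulam theorem.\<close>

lemma meager_in_sections:
  assumes "second_countable Z" "meager_in (prod_topology Z X) M"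
  obtains Q where "meager_in X Q" "\<And>x. x \<in> topspace X - Q \<Longrightarrow> meager_in Z {z. (z, x) \<in> M}"
proof -
  obtain \<B> where \<B>: "countable \<B>" "\<And>V. V \<in> \<B> \<Longrightarrow> openin Z V"
    "\<And>U x. openin Z U \<Longrightarrow> x \<in> U \<Longrightarrow> \<exists>V\<in>\<B>. x \<in> V \<and> V \<subseteq> U"
    using assms(1) unfolding second_countable_def by metis
  obtain N where N: "\<And>n. nowhere_dense_in (prod_topology Z X) (N n)" "M \<subseteq> (\<Union>n. N (n::nat))"
    using assms(2) unfolding meager_in_def by blast
  \<comment> \<open>\<open>x\<close> is good for \<open>n\<close> and a basic \<open>V\<close> if a
    whole box \<open>W \<times> U\<close> with \<open>W\<close> inside \<open>V\<close> and
    \<open>x\<close> in \<open>U\<close> misses \<open>N n\<close>. The points that are not good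
    form a nowhere dense set, and a point good for all \<open>n\<close> and all nonempty
    \<open>V\<close> has nowhere dense sections.\<close>
  let ?good = "\<lambda>n V. {x. \<exists>W U. openin Z W \<and> W \<noteq> {} \<and> W \<subseteq> V \<and> openin X U \<and> x \<in> U \<and> W \<times> U \<inter> N n = {}}"
  let ?Q = "\<Union>(n, V)\<in>UNIV \<times> (\<B> - {{}}). topspace X - ?good n V"
  have "nowhere_dense_in X (topspace X - ?good n V)" if V: "V \<in> \<B> - {{}}" for n V
    unfolding nowhere_dense_in_disjoint_iff
  proof (intro conjI allI impI)
    fix U assume U: "openin X U \<and> U \<noteq> {}"
    then have "openin (prod_topology Z X) (V \<times> U) \<and> V \<times> U \<noteq> {}"
      using V \<B>(2) by (auto simp: openin_prod_Times_iff)
    then obtain P where P: "openin (prod_topology Z X) P" "P \<noteq> {}" "P \<subseteq> V \<times> U" "P \<inter> N n = {}"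
      using N(1)[of n] unfolding nowhere_dense_in_disjoint_iff by blast
    then obtain z x where zx: "(z, x) \<in> P" by fast
    then obtain W' U' where W: "openin Z W'" "openin X U'" "z \<in> W'" "x \<in> U'" "W' \<times> U' \<subseteq> P"
      using P(1) unfolding openin_prod_topology_alt by meson
    then have "W' \<subseteq> V" "U' \<subseteq> U" using P(3) by auto
    moreover have "U' \<subseteq> ?good n V"
      using W P(4) \<open>W' \<subseteq> V\<close> by blast
    ultimately show "\<exists>V'. openin X V' \<and> V' \<noteq> {} \<and> V' \<subseteq> U \<and> V' \<inter> (topspace X - ?good n V) = {}"
      using W by blast
  qed auto
  then have "meager_in X ?Q"
    using \<B>(1) by (intro meager_in_UN) (auto intro: nowhere_dense_imp_meager)
  moreover have "meager_in Z {z. (z, x) \<in> M}" if x: "x \<in> topspace X - ?Q" for x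
    unfolding meager_in_def
  proof (intro exI[of _ "\<lambda>n. {z. (z, x) \<in> N n}"] conjI allI)
    show "{z. (z, x) \<in> M} \<subseteq> (\<Union>n. {z. (z, x) \<in> N n})" using N(2) by blast
    fix n
    show "nowhere_dense_in Z {z. (z, x) \<in> N n}"
      unfolding nowhere_dense_in_disjoint_iff
    proof (intro conjI allI impI)
      show "{z. (z, x) \<in> N n} \<subseteq> topspace Z"
        using N(1)[of n] unfolding nowhere_dense_in_def by auto
      fix U assume "openin Z U \<and> U \<noteq> {}"
      then obtain V where V: "V \<in> \<B> - {{}}" "V \<subseteq> U" using \<B>(3) by blast
      then have "x \<in> ?good n V" using x by blast
      then obtain W where "openin Z W" "W \<noteq> {}" "W \<subseteq> V" "\<forall>z\<in>W. (z, x) \<notin> N n" by blast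
      then show "\<exists>W. openin Z W \<and> W \<noteq> {} \<and> W \<subseteq> U \<and> W \<inter> {z. (z, x) \<in> N n} = {}"
        using V by blast
    qed
  qed
  ultimately show thesis using that by blast
qed

section \<open>Relations that preserve measurability\<close>

text \<open>The family \<open>M\<close> is arbitrary because it is instantiated by the sets with the
  Baire property both in \<open>X\<close> and in \<open>prod_topology TG X\<close>; the domain
  \<open>A\<close> is explicit because maps get restricted to open sets.\<close>

definition measurable_into :: "'z set set \<Rightarrow> 'z set \<Rightarrow> 'y topology \<Rightarrow> ('z \<Rightarrow> 'y) \<Rightarrow> bool" where
  "measurable_into M A Y a \<longleftrightarrow>
     a \<in> A \<rightarrow> topspace Y \<and> (\<forall>U. openin Y U \<longrightarrow> {z \<in> A. a z \<in> U} \<in> M)"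

text \<open>Tests \<open>F\<close> only through pairs of measurable maps, so no sigma-algebra on
  \<open>Y \<times> Y\<close> is involved and closure under the operations of Class 4 is direct. All
  domains in \<open>M\<close> are allowed because the sum splits the domain into pieces.\<close>

definition measurable_rel :: "'z set set \<Rightarrow> 'y topology \<Rightarrow> ('y \<times> 'y) set \<Rightarrow> bool" where
  "measurable_rel M Y F \<longleftrightarrow>
     (\<forall>A\<in>M. \<forall>a b. measurable_into M A Y a \<and> measurable_into M A Y b \<longrightarrow>
        {z \<in> A. (a z, b z) \<in> F} \<in> M)"

lemma measurable_intoI:
  assumes "\<And>z. z \<in> A \<Longrightarrow> a z \<in> topspace Y" "\<And>U. openin Y U \<Longrightarrow> {z \<in> A. a z \<in> U} \<in> M"
  shows "measurable_into M A Y a"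
  using assms unfolding measurable_into_def by blast

lemma measurable_intoD:
  assumes "measurable_into M A Y a"
  shows "z \<in> A \<Longrightarrow> a z \<in> topspace Y" "openin Y U \<Longrightarrow> {z \<in> A. a z \<in> U} \<in> M"
  using assms unfolding measurable_into_def by blast+

lemma measurable_relI:
  assumes "\<And>A a b. A \<in> M \<Longrightarrow> measurable_into M A Y a \<Longrightarrow> measurable_into M A Y b \<Longrightarrow>
    {z \<in> A. (a z, b z) \<in> F} \<in> M"
  shows "measurable_rel M Y F"
  using assms unfolding measurable_rel_def by blast

lemma measurable_relD:
  assumes "measurable_rel M Y F" "A \<in> M" "measurable_into M A Y a" "measurable_into M A Y b"
  shows "{z \<in> A. (a z, b z) \<in> F} \<in> M"
  using assms unfolding measurable_rel_def by blast

lemma measurable_into_compose: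
  assumes "measurable_into M A X a" "continuous_map X Y h"
  shows "measurable_into M A Y (\<lambda>z. h (a z))"
proof (rule measurable_intoI)
  show "h (a z) \<in> topspace Y" if "z \<in> A" for z
    using measurable_intoD(1)[OF assms(1) that] assms(2) by (auto simp: continuous_map_def)
  fix U assume "openin Y U"
  then have "{z \<in> A. a z \<in> {x \<in> topspace X. h x \<in> U}} \<in> M"
    by (intro measurable_intoD(2)[OF assms(1)] openin_continuous_map_preimage[OF assms(2)])
  moreover have "{z \<in> A. a z \<in> {x \<in> topspace X. h x \<in> U}} = {z \<in> A. h (a z) \<in> U}"
    using measurable_intoD(1)[OF assms(1)] by blast
  ultimately show "{z \<in> A. h (a z) \<in> U} \<in> M" by simp
qed

lemma measurable_rel_pullback:
  assumes "continuous_map X Y h" "measurable_rel M Y F"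
  shows "measurable_rel M X (pullback_rel X h F)"
proof (rule measurable_relI)
  fix A a b
  assume A: "A \<in> M" and ab: "measurable_into M A X a" "measurable_into M A X b"
  have "{z \<in> A. (h (a z), h (b z)) \<in> F} \<in> M"
    by (intro measurable_relD[OF assms(2) A] measurable_into_compose[OF _ assms(1)] ab)
  moreover have "{z \<in> A. (a z, b z) \<in> pullback_rel X h F} = {z \<in> A. (h (a z), h (b z)) \<in> F}"
    using measurable_intoD(1)[OF ab(1)] measurable_intoD(1)[OF ab(2)] by (auto simp: pullback_rel_def)
  ultimately show "{z \<in> A. (a z, b z) \<in> pullback_rel X h F} \<in> M" by simp
qed

context sigma_algebra
begin

lemma measurable_into_const:
  "A \<in> M \<Longrightarrow> y \<in> topspace Y \<Longrightarrow> measurable_into M A Y (\<lambda>_. y)"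
proof (rule measurable_intoI)
  fix U show "A \<in> M \<Longrightarrow> {z \<in> A. y \<in> U} \<in> M" by (cases "y \<in> U") auto
qed

lemma measurable_into_subset:
  assumes "measurable_into M A Y a" "B \<in> M" "B \<subseteq> A"
  shows "measurable_into M B Y a"
proof (rule measurable_intoI)
  fix U assume "openin Y U"
  then have "B \<inter> {z \<in> A. a z \<in> U} \<in> M" by (intro Int assms measurable_intoD(2)[OF assms(1)])
  moreover have "B \<inter> {z \<in> A. a z \<in> U} = {z \<in> B. a z \<in> U}" using assms(3) by blast
  ultimately show "{z \<in> B. a z \<in> U} \<in> M" by simp
qed (use assms(3) measurable_intoD(1)[OF assms(1)] in auto)

lemma measurable_rel_full:
  "measurable_rel M Y (topspace Y \<times> topspace Y)"
proof (rule measurable_relI)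
  fix A a b
  assume A: "A \<in> M" and ab: "measurable_into M A Y a" "measurable_into M A Y b"
  then have "{z \<in> A. (a z, b z) \<in> topspace Y \<times> topspace Y} = A"
    using measurable_intoD(1) by fastforce
  then show "{z \<in> A. (a z, b z) \<in> topspace Y \<times> topspace Y} \<in> M" using A by simp
qed

text \<open>Two points of a Hausdorff space with a countable basis differ exactly when some basic
  set contains the first and not the second, so disagreement is a countable union of measurable
  sets.\<close>

lemma measurable_rel_Id_on:
  assumes "Polish_space Y" shows "measurable_rel M Y (Id_on (topspace Y))"
proof (rule measurable_relI)
  fix A a b
  assume A: "A \<in> M" and ab: "measurable_into M A Y a" "measurable_into M A Y b"
  obtain \<B> where \<B>: "countable \<B>" "\<And>V. V \<in> \<B> \<Longrightarrow> openin Y V"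
    "\<And>U x. openin Y U \<Longrightarrow> x \<in> U \<Longrightarrow> \<exists>V\<in>\<B>. x \<in> V \<and> V \<subseteq> U"
    using second_countable_Polish_space[OF assms] unfolding second_countable_def by metis
  have H: "Hausdorff_space Y"
    using assms completely_metrizable_imp_metrizable_space metrizable_imp_Hausdorff_space
    unfolding Polish_space_def by blast
  let ?D = "\<Union>V\<in>\<B>. ({z \<in> A. a z \<in> V} - {z \<in> A. b z \<in> V})"
  have "?D \<in> M"
    using \<B>(1,2) ab by (intro countable_UN'' Diff measurable_intoD(2)) auto
  then have "A - ?D \<in> M" using A by blast
  moreover have "{z \<in> A. (a z, b z) \<in> Id_on (topspace Y)} = A - ?D"
  proof (intro equalityI subsetI)
    fix z assume z: "z \<in> A - ?D"
    then have zY: "a z \<in> topspace Y" "b z \<in> topspace Y"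
      using measurable_intoD(1)[OF ab(1)] measurable_intoD(1)[OF ab(2)] by auto
    have "a z = b z"
    proof (rule ccontr)
      assume "a z \<noteq> b z"
      then obtain U V where "openin Y U" "a z \<in> U" "b z \<in> V" "disjnt U V"
        using H zY unfolding Hausdorff_space_def by blast
      then have "openin Y U" "a z \<in> U" "b z \<notin> U" by (auto simp: disjnt_iff)
      then show False using \<B>(3) z by blast
    qed
    then show "z \<in> {z \<in> A. (a z, b z) \<in> Id_on (topspace Y)}" using z zY by auto
  qed auto
  ultimately show "{z \<in> A. (a z, b z) \<in> Id_on (topspace Y)} \<in> M" by simp
qed

lemma measurable_rel_UN:
  assumes "\<And>k::nat. measurable_rel M Y (F k)"
  shows "measurable_rel M Y (\<Union>k. F k)"
proof (rule measurable_relI)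
  fix A a b
  assume A: "A \<in> M" and ab: "measurable_into M A Y a" "measurable_into M A Y b"
  have "(\<Union>k. {z \<in> A. (a z, b z) \<in> F k}) \<in> M"
    by (intro countable_nat_UN image_subsetI measurable_relD[OF assms A] ab)
  moreover have "{z \<in> A. (a z, b z) \<in> (\<Union>k. F k)} = (\<Union>k. {z \<in> A. (a z, b z) \<in> F k})" by auto
  ultimately show "{z \<in> A. (a z, b z) \<in> (\<Union>k. F k)} \<in> M" by simp
qed

lemma measurable_rel_INT:
  assumes "\<And>k::nat. measurable_rel M Y (F k)"
  shows "measurable_rel M Y (\<Inter>k. F k)"
proof (rule measurable_relI)
  fix A a b
  assume A: "A \<in> M" and ab: "measurable_into M A Y a" "measurable_into M A Y b"
  have "(\<Inter>k. {z \<in> A. (a z, b z) \<in> F k}) \<in> M"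
    by (intro countable_INT image_subsetI measurable_relD[OF assms A] ab) auto
  moreover have "{z \<in> A. (a z, b z) \<in> (\<Inter>k. F k)} = (\<Inter>k. {z \<in> A. (a z, b z) \<in> F k})" by auto
  ultimately show "{z \<in> A. (a z, b z) \<in> (\<Inter>k. F k)} \<in> M" by simp
qed

lemma measurable_into_sum_topology:
  assumes "measurable_into M A (sum_topology Y UNIV) a"
  shows "{z \<in> A. fst (a z) = k} \<in> M"
    and "measurable_into M {z \<in> A. fst (a z) = k} (Y k) (\<lambda>z. snd (a z))"
proof -
  have op: "openin (sum_topology Y UNIV) ({k} \<times> U)" if "openin (Y k) U" for U
  proof -
    have "openin (Y i) {x. (i, x) \<in> {k} \<times> U}" for i
      using that by (cases "i = k") auto
    then show ?thesis
      using openin_subset[OF that] unfolding openin_sum_topology by auto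
  qed
  have top: "snd (a z) \<in> topspace (Y (fst (a z)))" if "z \<in> A" for z
    using measurable_intoD(1)[OF assms that] by auto
  have "{z \<in> A. a z \<in> {k} \<times> U} = {z \<in> {z \<in> A. fst (a z) = k}. snd (a z) \<in> U}" for U
    by (auto simp: mem_Times_iff)
  then have U: "{z \<in> {z \<in> A. fst (a z) = k}. snd (a z) \<in> U} \<in> M" if "openin (Y k) U" for U
    using measurable_intoD(2)[OF assms op[OF that]] by simp
  have "{z \<in> {z \<in> A. fst (a z) = k}. snd (a z) \<in> topspace (Y k)} = {z \<in> A. fst (a z) = k}"
    using top by blast
  then show "{z \<in> A. fst (a z) = k} \<in> M" using U[OF openin_topspace] by simp
  show "measurable_into M {z \<in> A. fst (a z) = k} (Y k) (\<lambda>z. snd (a z))"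
    using top U by (intro measurable_intoI) auto
qed

lemma measurable_rel_sum:
  assumes "\<And>k. measurable_rel M (Y k) (F k)"
  shows "measurable_rel M (sum_topology Y UNIV) (sum_rel F)"
proof (rule measurable_relI)
  fix A a b
  assume A: "A \<in> M" and a: "measurable_into M A (sum_topology Y UNIV) a"
    and b: "measurable_into M A (sum_topology Y UNIV) b"
  let ?A = "\<lambda>k. {z \<in> A. fst (a z) = k} \<inter> {z \<in> A. fst (b z) = k}"
  have "{z \<in> ?A k. (snd (a z), snd (b z)) \<in> F k} \<in> M" for k
  proof -
    have "?A k \<in> M" by (intro Int measurable_into_sum_topology(1)[OF a] measurable_into_sum_topology(1)[OF b])
    then show ?thesis
      by (intro measurable_relD[OF assms] measurable_into_subset[OF measurable_into_sum_topology(2)[OF a]]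
          measurable_into_subset[OF measurable_into_sum_topology(2)[OF b]]) auto
  qed
  then have "(\<Union>k. {z \<in> ?A k. (snd (a z), snd (b z)) \<in> F k}) \<in> M" by blast
  moreover have "{z \<in> A. (a z, b z) \<in> sum_rel F} = (\<Union>k. {z \<in> ?A k. (snd (a z), snd (b z)) \<in> F k})"
    by (auto simp: sum_rel_def case_prod_beta)
  ultimately show "{z \<in> A. (a z, b z) \<in> sum_rel F} \<in> M" by simp
qed

lemma sets_Collect_in:
  assumes "A \<in> M"
  shows "(\<And>k. {z \<in> A. P k z} \<in> M) \<Longrightarrow> {z \<in> A. \<forall>k::nat. P k z} \<in> M"
    and "(\<And>k. {z \<in> A. P k z} \<in> M) \<Longrightarrow> {z \<in> A. \<exists>k::nat. P k z} \<in> M"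
    and "{z \<in> A. p z} \<in> M \<Longrightarrow> {z \<in> A. q z} \<in> M \<Longrightarrow> {z \<in> A. p z \<and> q z} \<in> M"
proof -
  have *: "{z \<in> A. \<forall>k. P k z} = (\<Inter>k. {z \<in> A. P k z})" "{z \<in> A. \<exists>k. P k z} = (\<Union>k. {z \<in> A. P k z})"
    "{z \<in> A. p z \<and> q z} = {z \<in> A. p z} \<inter> {z \<in> A. q z}" by auto
  show "(\<And>k. {z \<in> A. P k z} \<in> M) \<Longrightarrow> {z \<in> A. \<forall>k::nat. P k z} \<in> M"
    unfolding * by (rule countable_INT) auto
  show "(\<And>k. {z \<in> A. P k z} \<in> M) \<Longrightarrow> {z \<in> A. \<exists>k::nat. P k z} \<in> M"
    unfolding * by (rule countable_nat_UN) auto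
  show "{z \<in> A. p z} \<in> M \<Longrightarrow> {z \<in> A. q z} \<in> M \<Longrightarrow> {z \<in> A. p z \<and> q z} \<in> M"
    unfolding * by (rule Int)
qed

lemma measurable_rel_power:
  assumes "measurable_rel M Y F"
  shows "measurable_rel M (product_topology (\<lambda>_::nat. Y) UNIV) (power_rel F)"
proof (rule measurable_relI)
  let ?Y = "product_topology (\<lambda>_::nat. Y) UNIV"
  fix A a b
  assume A: "A \<in> M" and ab: "measurable_into M A ?Y a" "measurable_into M A ?Y b"
  have proj: "continuous_map ?Y Y (\<lambda>x. x k)" for k
    using continuous_map_product_projection[of k UNIV "\<lambda>_. Y"] by simp
  have "{z \<in> A. (a z k, b z l) \<in> F} \<in> M" for k l
    by (intro measurable_relD[OF assms A] measurable_into_compose[OF ab(1) proj]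
        measurable_into_compose[OF ab(2) proj])
  then show "{z \<in> A. (a z, b z) \<in> power_rel F} \<in> M"
    unfolding power_rel_def mem_Collect_eq case_prod_conv by (intro sets_Collect_in A)
qed

end

section \<open>Local orbits of continuous actions\<close>

lemma local_equiv_least: "equiv S E \<Longrightarrow> local_rel \<phi> H S \<subseteq> E \<Longrightarrow> local_equiv \<phi> H S \<subseteq> E"
  unfolding local_equiv_def by blast

lemma local_rel_subset_local_equiv: "local_rel \<phi> H S \<subseteq> local_equiv \<phi> H S"
  unfolding local_equiv_def by blast

lemma local_equiv_equiv: "equiv S (local_equiv \<phi> H S)"
proof -
  have "equiv S (S \<times> S)" "local_rel \<phi> H S \<subseteq> S \<times> S"
    by (auto simp: equiv_def refl_on_def sym_def trans_def local_rel_def)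
  then have sub: "local_equiv \<phi> H S \<subseteq> S \<times> S" by (rule local_equiv_least)
  show ?thesis
  proof (rule equivI)
    show "refl_on S (local_equiv \<phi> H S)"
      using sub unfolding local_equiv_def refl_on_def equiv_def by blast
    show "sym (local_equiv \<phi> H S)"
      unfolding local_equiv_def sym_def equiv_def by blast
    show "trans (local_equiv \<phi> H S)"
      unfolding local_equiv_def trans_def equiv_def by blast
  qed (rule sub)
qed

text \<open>Induction principle for local orbits: the partition of \<open>S\<close> into
  \<open>W\<close> and its complement is an equivalence relation containing the generating steps,
  hence it contains \<open>local_equiv\<close>.\<close>

lemma local_orbit_invariant:
  assumes inv: "\<And>g x. g \<in> H \<Longrightarrow> x \<in> S \<Longrightarrow> \<phi> g x \<in> S \<Longrightarrow> x \<in> W \<longleftrightarrow> \<phi> g x \<in> W"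
    and x: "x \<in> S" "y \<in> local_orbit \<phi> S H x"
  shows "x \<in> W \<longleftrightarrow> y \<in> W"
proof -
  let ?E = "{(x, y). x \<in> S \<and> y \<in> S \<and> (x \<in> W \<longleftrightarrow> y \<in> W)}"
  have "equiv S ?E"
    by (auto simp: equiv_def refl_on_def sym_def trans_def)
  moreover have "local_rel \<phi> H S \<subseteq> ?E"
    using inv by (auto simp: local_rel_def)
  ultimately show ?thesis
    using local_equiv_least[of S ?E \<phi> H] x(2) unfolding local_orbit_def by blast
qed

lemma local_orbit_subset: "local_orbit \<phi> S H x \<subseteq> S"
  using local_equiv_equiv[of S \<phi> H] unfolding local_orbit_def equiv_def by blast

lemma local_orbit_refl: "x \<in> S \<Longrightarrow> x \<in> local_orbit \<phi> S H x"
  using local_equiv_equiv[of S \<phi> H] unfolding local_orbit_def equiv_def refl_on_def by blast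

lemma local_orbit_sym: "y \<in> local_orbit \<phi> S H x \<Longrightarrow> x \<in> local_orbit \<phi> S H y"
  using local_equiv_equiv[of S \<phi> H] unfolding local_orbit_def equiv_def sym_def by blast

lemma local_orbit_eq:
  "y \<in> local_orbit \<phi> S H x \<Longrightarrow> local_orbit \<phi> S H y = local_orbit \<phi> S H x"
  unfolding local_orbit_def using equiv_class_eq[OF local_equiv_equiv] by fastforce

lemma local_orbit_step:
  assumes "g \<in> H" "x \<in> S" "y \<in> S" "y = \<phi> g x"
  shows "y \<in> local_orbit \<phi> S H x"
proof -
  have "(y, x) \<in> local_equiv \<phi> H S"
    using local_rel_subset_local_equiv assms unfolding local_rel_def by fast
  then show ?thesis
    using local_equiv_equiv[of S \<phi> H] unfolding local_orbit_def equiv_def sym_def by blast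
qed

lemma local_orbit_step_iff:
  assumes "g \<in> H" "y \<in> S" "\<phi> g y \<in> S"
  shows "y \<in> local_orbit \<phi> S H x \<longleftrightarrow> \<phi> g y \<in> local_orbit \<phi> S H x"
proof -
  have *: "\<phi> g y \<in> local_orbit \<phi> S H y" using local_orbit_step[OF assms] by simp
  show ?thesis
  proof
    assume "y \<in> local_orbit \<phi> S H x"
    then show "\<phi> g y \<in> local_orbit \<phi> S H x" using * by (simp add: local_orbit_eq)
  next
    assume "\<phi> g y \<in> local_orbit \<phi> S H x"
    then show "y \<in> local_orbit \<phi> S H x" using local_orbit_sym[OF *] by (simp add: local_orbit_eq)
  qed
qed

text \<open>No step of the local action enters or leaves \<open>T\<close>, so every path in
  \<open>S\<close> that starts in \<open>T\<close> stays in \<open>T\<close>.\<close>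

lemma local_orbit_restrict:
  assumes inv: "\<And>g x. g \<in> H \<Longrightarrow> x \<in> S \<Longrightarrow> \<phi> g x \<in> S \<Longrightarrow> x \<in> T \<longleftrightarrow> \<phi> g x \<in> T"
    and "T \<subseteq> S" "x \<in> T"
  shows "local_orbit \<phi> T H x = local_orbit \<phi> S H x"
proof
  have "x \<in> local_orbit \<phi> S H x" using assms(2,3) by (intro local_orbit_refl) blast
  moreover have "y \<in> local_orbit \<phi> S H x \<longleftrightarrow> \<phi> g y \<in> local_orbit \<phi> S H x"
    if "g \<in> H" "y \<in> T" "\<phi> g y \<in> T" for g y
    using that assms(2) by (intro local_orbit_step_iff) auto
  ultimately show "local_orbit \<phi> T H x \<subseteq> local_orbit \<phi> S H x"
    using local_orbit_invariant[of H T \<phi> "local_orbit \<phi> S H x" x] assms(3) by blast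
  \<comment> \<open>Comparison with the larger orbit requires invariance under steps in all of
    \<open>S\<close>; from a point outside \<open>T\<close> both sides are false.\<close>
  have *: "y \<in> local_orbit \<phi> T H x \<longleftrightarrow> \<phi> g y \<in> local_orbit \<phi> T H x"
    if g: "g \<in> H" "y \<in> S" "\<phi> g y \<in> S" for g y
  proof (cases "y \<in> T")
    case True
    then show ?thesis
      using inv[OF g] g(1) by (intro local_orbit_step_iff) auto
  next
    case False
    then show ?thesis using inv[OF g] local_orbit_subset[of \<phi> T H x] by blast
  qed
  show "local_orbit \<phi> S H x \<subseteq> local_orbit \<phi> T H x"
    using local_orbit_invariant[of H S \<phi> "local_orbit \<phi> T H x" x] * local_orbit_refl[of x T \<phi> H] assms(2,3)
    by blast
qed

section \<open>Translations and the action map of a continuous Polish group action\<close>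

locale polish_action =
  fixes G (structure) and TG :: "'g topology" and X :: "'x topology" and \<phi>
  assumes Polish_group: "Polish_group G TG" and Polish_space: "Polish_space X"
    and continuous_action: "continuous_action G TG X \<phi>"
begin

sublocale group G
  using Polish_group unfolding Polish_group_def by blast

sublocale group_action G "topspace X" \<phi>
  using continuous_action unfolding continuous_action_def by blast

lemma topspace_TG: "topspace TG = carrier G"
  using Polish_group unfolding Polish_group_def by blast

lemma act_closed: "g \<in> carrier G \<Longrightarrow> x \<in> topspace X \<Longrightarrow> \<phi> g x \<in> topspace X"
  using element_image by blast

lemma act_inv: "g \<in> carrier G \<Longrightarrow> x \<in> topspace X \<Longrightarrow> \<phi> (inv g) (\<phi> g x) = x"
  using orbit_sym_aux by blast

lemma act_inv': "g \<in> carrier G \<Longrightarrow> x \<in> topspace X \<Longrightarrow> \<phi> g (\<phi> (inv g) x) = x"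
  using act_inv[of "inv g" x] by simp

lemma act_one: "x \<in> topspace X \<Longrightarrow> \<phi> \<one> x = x"
  using id_eq_one by (metis restrict_apply')

lemma completely_metrizable: "completely_metrizable_space X" "completely_metrizable_space TG"
  using Polish_space Polish_group unfolding Polish_space_def Polish_group_def by blast+

lemma not_meager: "openin X U \<Longrightarrow> U \<noteq> {} \<Longrightarrow> \<not> meager_in X U"
  by (rule not_meager_open[OF completely_metrizable(1)])

lemma second_countable: "second_countable X" "second_countable TG"
  using Polish_space Polish_group second_countable_Polish_space unfolding Polish_group_def by blast+

lemma continuous_act: "continuous_map (prod_topology TG X) X (\<lambda>(g, x). \<phi> g x)"
  using continuous_action unfolding continuous_action_def by blast

lemma continuous_translation:
  assumes "g \<in> carrier G" shows "continuous_map X X (\<phi> g)"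
proof -
  have "continuous_map X (prod_topology TG X) (\<lambda>x. (g, x))"
    using assms by (intro continuous_map_pairedI) (auto simp: topspace_TG)
  from continuous_map_compose[OF this continuous_act] show ?thesis
    by (simp add: o_def)
qed

lemma openin_translation_vimage:
  assumes "g \<in> carrier G" "openin X U"
  shows "openin X {x \<in> topspace X. \<phi> g x \<in> U}"
  using openin_continuous_map_preimage[OF continuous_translation] assms by blast

lemma open_translation:
  assumes "g \<in> carrier G" shows "open_map X X (\<phi> g)"
  unfolding open_map_def
proof (intro allI impI)
  fix U assume U: "openin X U"
  have "\<phi> g ` U = {x \<in> topspace X. \<phi> (inv g) x \<in> U}"
  proof (intro equalityI subsetI)
    fix y assume "y \<in> \<phi> g ` U"
    then show "y \<in> {x \<in> topspace X. \<phi> (inv g) x \<in> U}"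
      using U[THEN openin_subset] act_inv act_closed assms by fastforce
  next
    fix y assume "y \<in> {x \<in> topspace X. \<phi> (inv g) x \<in> U}"
    then show "y \<in> \<phi> g ` U"
      using act_inv'[of g y] assms by (metis (mono_tags, lifting) image_iff mem_Collect_eq)
  qed
  then show "openin X (\<phi> g ` U)"
    using openin_translation_vimage[of "inv g" U] U assms by simp
qed

lemma meager_translation_vimage:
  assumes "g \<in> carrier G" "meager_in X N"
  shows "meager_in X {x \<in> topspace X. \<phi> g x \<in> N}"
  using meager_in_vimage continuous_translation open_translation assms by blast

text \<open>The image is the union over \<open>g\<close> of the translates of the sections of
  \<open>P\<close>, and each translate is open.\<close>

lemma open_act: "open_map (prod_topology TG X) X (\<lambda>(g, x). \<phi> g x)"
  unfolding open_map_def
proof (intro allI impI)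
  fix P assume P: "openin (prod_topology TG X) P"
  have sub: "P \<subseteq> carrier G \<times> topspace X"
    using openin_subset[OF P] by (simp add: topspace_TG)
  have "openin X (\<phi> g ` {x. (g, x) \<in> P})" if g: "g \<in> carrier G" for g
  proof -
    have "continuous_map X (prod_topology TG X) (\<lambda>x. (g, x))"
      using g by (intro continuous_map_pairedI) (auto simp: topspace_TG)
    then have "openin X {x \<in> topspace X. (g, x) \<in> P}"
      using P openin_continuous_map_preimage by blast
    moreover have "{x \<in> topspace X. (g, x) \<in> P} = {x. (g, x) \<in> P}" using sub by blast
    ultimately show ?thesis using open_translation[OF g] unfolding open_map_def by simp
  qed
  then have "openin X (\<Union>g\<in>carrier G. \<phi> g ` {x. (g, x) \<in> P})" by blast
  moreover have "(\<Union>g\<in>carrier G. \<phi> g ` {x. (g, x) \<in> P}) = (\<lambda>(g, x). \<phi> g x) ` P"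
    using sub by force
  ultimately show "openin X ((\<lambda>(g, x). \<phi> g x) ` P)" by simp
qed

lemma continuous_right_translation:
  assumes "h \<in> carrier G" shows "continuous_map TG TG (\<lambda>g. g \<otimes> h)"
proof -
  have "continuous_map TG (prod_topology TG TG) (\<lambda>g. (g, h))"
    using assms by (intro continuous_map_pairedI) (auto simp: topspace_TG)
  moreover have "continuous_map (prod_topology TG TG) TG (\<lambda>(g, h). g \<otimes> h)"
    using Polish_group unfolding Polish_group_def by blast
  ultimately show ?thesis
    using continuous_map_compose by (fastforce simp: o_def)
qed

lemma open_right_translation:
  assumes "h \<in> carrier G" shows "open_map TG TG (\<lambda>g. g \<otimes> h)"
  unfolding open_map_def
proof (intro allI impI)
  fix U assume U: "openin TG U"
  have "(\<lambda>g. g \<otimes> h) ` U = {g \<in> topspace TG. g \<otimes> inv h \<in> U}"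
  proof (intro equalityI subsetI)
    fix y assume "y \<in> (\<lambda>g. g \<otimes> h) ` U"
    then show "y \<in> {g \<in> topspace TG. g \<otimes> inv h \<in> U}"
      using U[THEN openin_subset] assms by (auto simp: topspace_TG m_assoc subset_iff)
  next
    fix y assume "y \<in> {g \<in> topspace TG. g \<otimes> inv h \<in> U}"
    moreover from this have "y = (y \<otimes> inv h) \<otimes> h" using assms by (simp add: topspace_TG m_assoc)
    ultimately show "y \<in> (\<lambda>g. g \<otimes> h) ` U" by blast
  qed
  then show "openin TG ((\<lambda>g. g \<otimes> h) ` U)"
    using openin_continuous_map_preimage[OF continuous_right_translation U, of "inv h"] assms by simp
qed

lemma openin_displacement:
  assumes "openin TG U" "g \<in> carrier G"
  shows "openin TG {h \<in> carrier G. g \<otimes> inv h \<in> U}"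
proof -
  have inv: "continuous_map TG TG (\<lambda>g. inv g)"
    and mult: "continuous_map (prod_topology TG TG) TG (\<lambda>(g, h). g \<otimes> h)"
    using Polish_group unfolding Polish_group_def by blast+
  have "continuous_map TG (prod_topology TG TG) (\<lambda>h. (g, inv h))"
    using assms inv by (intro continuous_map_pairedI) (auto simp: topspace_TG)
  from continuous_map_compose[OF this mult] have "continuous_map TG TG (\<lambda>h. g \<otimes> inv h)"
    by (simp add: o_def)
  from openin_continuous_map_preimage[OF this assms(1)] show ?thesis
    by (simp add: topspace_TG)
qed

section \<open>The zero-one law for local actions, and dense local orbits from turbulence\<close>

lemma local_invariant_comeager_in_nbhd:
  assumes "openin X S" "H \<subseteq> carrier G" "meager_in X (S - D)"
    and inv: "\<And>g x. g \<in> H \<Longrightarrow> x \<in> S \<inter> D \<Longrightarrow> \<phi> g x \<in> S \<inter> D \<Longrightarrow> x \<in> W \<longleftrightarrow> \<phi> g x \<in> W"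
    and g: "g \<in> H" and x: "x \<in> S" "\<phi> g x \<in> S"
  shows "(\<exists>U. openin X U \<and> x \<in> U \<and> U \<subseteq> S \<and> meager_in X (U - W)) \<longleftrightarrow>
    (\<exists>U. openin X U \<and> \<phi> g x \<in> U \<and> U \<subseteq> S \<and> meager_in X (U - W))"
proof -
  have gG: "g \<in> carrier G" "inv g \<in> carrier G" using assms(2) g by auto
  have SX: "S \<subseteq> topspace X" using assms(1) openin_subset by blast
  have transfer: "\<exists>V. openin X V \<and> \<phi> f y \<in> V \<and> V \<subseteq> S \<and> meager_in X (V - W)"
    if f: "f \<in> carrier G" and y: "y \<in> S" "\<phi> f y \<in> S"
      and U: "openin X U" "y \<in> U" "U \<subseteq> S" "meager_in X (U - W)"
      and finv: "\<And>z. z \<in> S \<inter> D \<Longrightarrow> \<phi> f z \<in> S \<inter> D \<Longrightarrow> z \<in> W \<Longrightarrow> \<phi> f z \<in> W" for f y U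
  proof (intro exI conjI)
    let ?V = "S \<inter> {v \<in> topspace X. \<phi> (inv f) v \<in> U}"
    show "openin X ?V" using assms(1) openin_translation_vimage f U(1) by blast
    show "\<phi> f y \<in> ?V" using y U SX act_inv[OF f] by auto
    have "meager_in X ((S - D) \<union> {v \<in> topspace X. \<phi> (inv f) v \<in> (U - W) \<union> (S - D)})"
      using assms(3) U(4) f by (intro meager_in_Un meager_translation_vimage) auto
    then show "meager_in X (?V - W)"
    proof (rule meager_in_subset, intro subsetI)
      fix v assume v: "v \<in> ?V - W"
      have "\<phi> f (\<phi> (inv f) v) = v" using v act_inv'[OF f] by blast
      then show "v \<in> (S - D) \<union> {v \<in> topspace X. \<phi> (inv f) v \<in> (U - W) \<union> (S - D)}"
        using finv[of "\<phi> (inv f) v"] v U(3) by auto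
    qed
  qed auto
  show ?thesis
  proof
    assume "\<exists>U. openin X U \<and> x \<in> U \<and> U \<subseteq> S \<and> meager_in X (U - W)"
    then show "\<exists>U. openin X U \<and> \<phi> g x \<in> U \<and> U \<subseteq> S \<and> meager_in X (U - W)"
      using transfer[OF gG(1) x] inv[OF g] by metis
  next
    assume "\<exists>U. openin X U \<and> \<phi> g x \<in> U \<and> U \<subseteq> S \<and> meager_in X (U - W)"
    moreover have "\<phi> (inv g) z \<in> W" if "z \<in> S \<inter> D" "\<phi> (inv g) z \<in> S \<inter> D" "z \<in> W" for z
      using inv[OF g, of "\<phi> (inv g) z"] act_inv'[OF gG(1), of z] that SX by auto
    moreover have "\<phi> (inv g) (\<phi> g x) = x" using act_inv[OF gG(1)] x SX by blast
    ultimately show "\<exists>U. openin X U \<and> x \<in> U \<and> U \<subseteq> S \<and> meager_in X (U - W)"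
      using transfer[OF gG(2) x(2)] x(1) by metis
  qed
qed

text \<open>If neither alternative held, \<open>W\<close> would be comeager in an open
  \<open>A\<close> and its complement in an open \<open>B\<close>. A dense local orbit starting in
  \<open>B\<close> reaches \<open>A\<close>; as the set of points near which \<open>W\<close> is
  comeager is exactly invariant, \<open>W\<close> would also be comeager near a point of
  \<open>B\<close>.\<close>

lemma invariant_meager_or_comeager:
  assumes S: "openin X S" "H \<subseteq> carrier G" "meager_in X (S - D)"
    and dense: "meager_in X {x \<in> S. \<not> S \<subseteq> X closure_of (local_orbit \<phi> S H x)}"
    and W: "Baire_property_in X W" "W \<subseteq> S"
    and inv: "\<And>g x. g \<in> H \<Longrightarrow> x \<in> S \<inter> D \<Longrightarrow> \<phi> g x \<in> S \<inter> D \<Longrightarrow> x \<in> W \<longleftrightarrow> \<phi> g x \<in> W"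
  shows "meager_in X W \<or> meager_in X (S - W)"
proof (rule ccontr)
  assume "\<not> (meager_in X W \<or> meager_in X (S - W))"
  then have non: "\<not> meager_in X W" "\<not> meager_in X (S - W)" by auto
  obtain A where A: "openin X A" "A \<noteq> {}" "A \<subseteq> S" "meager_in X (A - W)"
    using Baire_property_nonmeager[OF W(1) non(1) W(2) S(1)] by metis
  have "Baire_property_in X (S - W)" using S(1) W(1) Baire_property_Diff Baire_property_openin by blast
  then obtain B where B: "openin X B" "B \<noteq> {}" "B \<subseteq> S" "meager_in X (B - (S - W))"
    using Baire_property_nonmeager[OF _ non(2) _ S(1)] by (metis Diff_subset)
  obtain x where x: "x \<in> B" "S \<subseteq> X closure_of (local_orbit \<phi> S H x)"
    using not_meager[OF B(1,2)] meager_in_subset[OF dense, of B] B(3) by blast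
  obtain y where y: "y \<in> A" "y \<in> local_orbit \<phi> S H x"
    using openin_Int_closure_of_eq_empty[OF A(1), of "local_orbit \<phi> S H x"] x(2) A(2,3) by blast
  let ?K = "{x. \<exists>U. openin X U \<and> x \<in> U \<and> U \<subseteq> S \<and> meager_in X (U - W)}"
  have "x \<in> ?K \<longleftrightarrow> y \<in> ?K"
  proof (rule local_orbit_invariant[of H S \<phi>])
    show "x \<in> S" "y \<in> local_orbit \<phi> S H x" using x(1) B(3) y(2) by auto
    show "z \<in> ?K \<longleftrightarrow> \<phi> g z \<in> ?K" if "g \<in> H" "z \<in> S" "\<phi> g z \<in> S" for g z
      unfolding mem_Collect_eq by (rule local_invariant_comeager_in_nbhd[OF S inv that])
  qed
  then obtain U where U: "openin X U" "x \<in> U" "meager_in X (U - W)"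
    using A y(1) by blast
  have "meager_in X (U \<inter> B)"
    by (rule meager_in_subset[OF meager_in_Un[OF U(3) B(4)]]) blast
  then show False using not_meager[of "U \<inter> B"] U B x(1) by blast
qed

text \<open>\<open>S'\<close> is the part of \<open>S\<close> inside the interior of the closure of
  one turbulent orbit. That part is invariant, so restriction to it leaves the orbits of its points
  unchanged, and the orbit of any turbulent point in it has a closure that covers the closure of the
  first orbit.\<close>

lemma dense_local_orbits:
  assumes turb: "meager_in X {x \<in> topspace X. \<not> turbulent_point G TG X \<phi> x}"
    and S: "openin X S" "S \<noteq> {}" and H: "openin TG H" "\<one> \<in> H"
  obtains S' where "openin X S'" "S' \<noteq> {}" "S' \<subseteq> S"
    "meager_in X {x \<in> S'. \<not> S' \<subseteq> X closure_of (local_orbit \<phi> S' H x)}"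
proof -
  have HG: "H \<subseteq> carrier G" using H openin_subset topspace_TG by blast
  have SX: "S \<subseteq> topspace X" using S(1) openin_subset by blast
  let ?O = "local_orbit \<phi> S H"
  let ?I = "\<lambda>x. S \<inter> X interior_of (X closure_of ?O x)"
  \<comment> \<open>Translation by \<open>f\<close> is a homeomorphism that keeps points of the
    orbit in the orbit as long as they land in \<open>S\<close>, so it carries the interior of the
    closure along. Again stated for any \<open>f\<close>, to cover inverses.\<close>
  have transfer: "\<phi> f y \<in> ?I x"
    if f: "f \<in> carrier G" and y: "y \<in> ?I x" "\<phi> f y \<in> S"
      and finv: "\<And>z. z \<in> ?O x \<Longrightarrow> \<phi> f z \<in> S \<Longrightarrow> \<phi> f z \<in> ?O x" for f x y
  proof -
    let ?U = "?I x \<inter> {v \<in> topspace X. \<phi> f v \<in> S}"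
    have U: "openin X ?U" using S(1) openin_translation_vimage[OF f S(1)] by (intro openin_Int) auto
    then have fU: "openin X (\<phi> f ` ?U)" using open_translation[OF f] unfolding open_map_def by blast
    have "\<phi> f ` ?U \<subseteq> X closure_of ?O x"
    proof
      fix w assume "w \<in> \<phi> f ` ?U"
      then obtain v where v: "v \<in> ?U" "w = \<phi> f v" by blast
      show "w \<in> X closure_of ?O x"
        unfolding in_closure_of
      proof (intro conjI allI impI)
        show "w \<in> topspace X" using v act_closed[OF f] by blast
        fix T assume T: "w \<in> T \<and> openin X T"
        have "openin X (?U \<inter> {v \<in> topspace X. \<phi> f v \<in> T})"
          using T by (intro openin_Int[OF U] openin_translation_vimage[OF f]) blast
        moreover have "v \<in> ?U \<inter> {v \<in> topspace X. \<phi> f v \<in> T}" using v T by blast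
        moreover have "v \<in> X closure_of ?O x" using v interior_of_subset[of X "X closure_of ?O x"] by blast
        ultimately have "\<exists>z. z \<in> ?O x \<and> z \<in> ?U \<inter> {v \<in> topspace X. \<phi> f v \<in> T}"
          unfolding in_closure_of by meson
        then show "\<exists>y. y \<in> ?O x \<and> y \<in> T" using finv by blast
      qed
    qed
    then have "\<phi> f ` ?U \<subseteq> X interior_of (X closure_of ?O x)" using fU interior_of_maximal by blast
    then show ?thesis using y S(1) openin_subset by blast
  qed
  note Oinv = local_orbit_step_iff[where S = S and H = H and \<phi> = \<phi>]
  have inv: "y \<in> ?I x \<longleftrightarrow> \<phi> g y \<in> ?I x" if g: "g \<in> H" and y: "y \<in> S" "\<phi> g y \<in> S" for g y x
  proof
    have gG: "g \<in> carrier G" "inv g \<in> carrier G" using HG g by auto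
    assume Iy: "y \<in> ?I x"
    have "\<phi> g z \<in> ?O x" if z: "z \<in> ?O x" "\<phi> g z \<in> S" for z
      using Oinv[OF g _ z(2)] z local_orbit_subset[of \<phi> S H x] by blast
    then show "\<phi> g y \<in> ?I x" using transfer[OF gG(1) Iy y(2)] by blast
  next
    have gG: "g \<in> carrier G" "inv g \<in> carrier G" using HG g by auto
    assume gy: "\<phi> g y \<in> ?I x"
    have *: "\<phi> (inv g) (\<phi> g y) = y" using act_inv[OF gG(1)] y SX by blast
    have "\<phi> (inv g) z \<in> ?O x" if z: "z \<in> ?O x" "\<phi> (inv g) z \<in> S" for z
    proof -
      have "z \<in> S" using z(1) local_orbit_subset[of \<phi> S H x] by blast
      then show ?thesis
        using Oinv[OF g, of "\<phi> (inv g) z" x] act_inv'[OF gG(1), of z] z SX by auto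
    qed
    then show "y \<in> ?I x" using transfer[OF gG(2) gy] * y by simp
  qed
  have somewhere: "?I x \<noteq> {}" "?I x \<inter> ?O x \<noteq> {}" if x: "x \<in> S" "turbulent_point G TG X \<phi> x" for x
  proof -
    have "somewhere_dense_in X (?O x)"
      using x S(1) H HG unfolding turbulent_point_def by blast
    then have "X interior_of (X closure_of ?O x) \<inter> ?O x \<noteq> {}"
      using openin_Int_closure_of_eq_empty[of X "X interior_of (X closure_of ?O x)" "?O x"]
        interior_of_subset[of X "X closure_of ?O x"]
      unfolding somewhere_dense_in_def by (metis inf.absorb_iff1 openin_interior_of)
    then show "?I x \<inter> ?O x \<noteq> {}" "?I x \<noteq> {}" using local_orbit_subset[of \<phi> S H x] by blast+
  qed
  obtain x0 where x0: "x0 \<in> S" "turbulent_point G TG X \<phi> x0"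
    using not_meager[OF S] meager_in_subset[OF turb, of S] SX by blast
  show thesis
  proof (rule that)
    show "openin X (?I x0)" using S(1) by (intro openin_Int) auto
    show "?I x0 \<noteq> {}" using somewhere[OF x0] by blast
    show "meager_in X {x \<in> ?I x0. \<not> ?I x0 \<subseteq> X closure_of (local_orbit \<phi> (?I x0) H x)}"
    proof (rule meager_in_subset[OF turb], intro subsetI, rule ccontr)
      fix x assume x: "x \<in> {x \<in> ?I x0. \<not> ?I x0 \<subseteq> X closure_of (local_orbit \<phi> (?I x0) H x)}"
        and "x \<notin> {x \<in> topspace X. \<not> turbulent_point G TG X \<phi> x}"
      then have xt: "x \<in> S" "turbulent_point G TG X \<phi> x" using SX by auto
      have orb: "local_orbit \<phi> (?I x0) H x = ?O x"
      proof (rule local_orbit_restrict)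
        show "y \<in> ?I x0 \<longleftrightarrow> \<phi> g y \<in> ?I x0" if "g \<in> H" "y \<in> S" "\<phi> g y \<in> S" for g y
          by (rule inv[OF that])
        show "?I x0 \<subseteq> S" "x \<in> ?I x0" using x by auto
      qed
      have "?O x \<subseteq> ?I x0"
        using local_orbit_subset[of \<phi> "?I x0" H x] unfolding orb .
      \<comment> \<open>The orbit of \<open>x\<close> lies in \<open>?I x0\<close> and,
        \<open>x\<close> being turbulent, enters its own \<open>?I x\<close>, so the two sets meet.
        Hence the orbit of \<open>x0\<close>, dense in \<open>?I x0\<close>, enters
        \<open>?I x\<close> and by invariance lies wholly in it.\<close>
      then have "?I x \<inter> ?I x0 \<noteq> {}" using somewhere(2)[OF xt] by blast
      moreover have "openin X (?I x \<inter> ?I x0)" by (intro openin_Int S(1) openin_interior_of)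
      moreover have "?I x \<inter> ?I x0 \<subseteq> X closure_of ?O x0"
        using interior_of_subset[of X "X closure_of ?O x0"] by blast
      ultimately obtain z where z: "z \<in> ?I x" "z \<in> ?O x0"
        using openin_Int_closure_of_eq_empty[of X "?I x \<inter> ?I x0" "?O x0"] by blast
      have "?O x0 \<subseteq> ?I x"
      proof
        fix w assume "w \<in> ?O x0"
        then have "w \<in> ?O z" using local_orbit_eq[OF z(2)] by simp
        then show "w \<in> ?I x"
          using local_orbit_invariant[of H S \<phi> "?I x" z w] inv z(1) by blast
      qed
      then have "X closure_of ?O x0 \<subseteq> X closure_of ?O x"
        using interior_of_subset[of X "X closure_of ?O x"] by (intro closure_of_minimal) auto
      then have "?I x0 \<subseteq> X closure_of ?O x"
        using interior_of_subset[of X "X closure_of ?O x0"] by blast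
      moreover have "\<not> ?I x0 \<subseteq> X closure_of ?O x" using x unfolding orb mem_Collect_eq by (rule conjunct2)
      ultimately show False by (rule notE[rotated])
    qed
  qed simp
qed

section \<open>Ergodic relations and their direct closure properties\<close>

definition local_orbits_dense :: "'x set \<Rightarrow> 'g set \<Rightarrow> bool" where
  "local_orbits_dense S H \<longleftrightarrow> openin X S \<and> S \<noteq> {} \<and> openin TG H \<and> \<one> \<in> H \<and>
     meager_in X {x \<in> S. \<not> S \<subseteq> X closure_of (local_orbit \<phi> S H x)}"

text \<open>Constrains single steps with both ends in \<open>D\<close>, because \<open>D\<close> is
  not assumed invariant and a path in a local orbit may leave it.\<close>

definition generically_invariant :: "'x set \<Rightarrow> 'g set \<Rightarrow> 'x set \<Rightarrow> ('y \<times> 'y) set \<Rightarrow> ('x \<Rightarrow> 'y) \<Rightarrow> bool" where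
  "generically_invariant S H D F \<theta> \<longleftrightarrow> meager_in X (S - D) \<and>
     (\<forall>h\<in>H. \<forall>x\<in>S \<inter> D. \<phi> h x \<in> S \<inter> D \<longrightarrow> (\<theta> x, \<theta> (\<phi> h x)) \<in> F)"

definition constant_mod_meager :: "'x set \<Rightarrow> ('y \<times> 'y) set \<Rightarrow> ('x \<Rightarrow> 'y) \<Rightarrow> bool" where
  "constant_mod_meager S F \<theta> \<longleftrightarrow> (\<exists>C\<subseteq>S. meager_in X (S - C) \<and> (\<forall>x\<in>C. \<forall>y\<in>C. (\<theta> x, \<theta> y) \<in> F))"

text \<open>The statement carried through the induction. Measurability on \<open>X\<close> gives the
  Baire property to the classes fed into the zero-one law; measurability on the product gives it to
  the sets of pairs \<open>(g, x)\<close> in the category step.\<close>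

definition ergodic_rel :: "'y topology \<Rightarrow> ('y \<times> 'y) set \<Rightarrow> bool" where
  "ergodic_rel Y F \<longleftrightarrow>
     equiv (topspace Y) F \<and>
     measurable_rel {A. Baire_property_in X A} Y F \<and>
     measurable_rel {A. Baire_property_in (prod_topology TG X) A} Y F \<and>
     (\<forall>S H D \<theta>. local_orbits_dense S H \<and> measurable_into {A. Baire_property_in X A} S Y \<theta> \<and>
        generically_invariant S H D F \<theta> \<longrightarrow> constant_mod_meager S F \<theta>)"

lemma ergodic_relI:
  assumes "equiv (topspace Y) F" "measurable_rel {A. Baire_property_in X A} Y F"
    "measurable_rel {A. Baire_property_in (prod_topology TG X) A} Y F"
    "\<And>S H D \<theta>. local_orbits_dense S H \<Longrightarrow> measurable_into {A. Baire_property_in X A} S Y \<theta> \<Longrightarrow>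
        generically_invariant S H D F \<theta> \<Longrightarrow> constant_mod_meager S F \<theta>"
  shows "ergodic_rel Y F"
  using assms unfolding ergodic_rel_def by blast

lemma ergodic_relD:
  assumes "ergodic_rel Y F"
  shows "equiv (topspace Y) F" "measurable_rel {A. Baire_property_in X A} Y F"
    "measurable_rel {A. Baire_property_in (prod_topology TG X) A} Y F"
    "local_orbits_dense S H \<Longrightarrow> measurable_into {A. Baire_property_in X A} S Y \<theta> \<Longrightarrow>
        generically_invariant S H D F \<theta> \<Longrightarrow> constant_mod_meager S F \<theta>"
  using assms unfolding ergodic_rel_def by blast+

lemma constant_mod_meagerI:
  assumes "C \<subseteq> S" "meager_in X (S - C)" "\<And>x y. x \<in> C \<Longrightarrow> y \<in> C \<Longrightarrow> (\<theta> x, \<theta> y) \<in> F"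
  shows "constant_mod_meager S F \<theta>"
  using assms unfolding constant_mod_meager_def by blast

lemma constant_mod_meagerE:
  assumes "constant_mod_meager S F \<theta>"
  obtains C where "C \<subseteq> S" "meager_in X (S - C)" "\<And>x y. x \<in> C \<Longrightarrow> y \<in> C \<Longrightarrow> (\<theta> x, \<theta> y) \<in> F"
  using assms unfolding constant_mod_meager_def by blast

lemma measurable_into_open_subset:
  assumes "measurable_into {A. Baire_property_in X A} S Y \<theta>" "openin X T" "T \<subseteq> S"
  shows "measurable_into {A. Baire_property_in X A} T Y \<theta>"
  using Baire_property.measurable_into_subset[OF assms(1)] Baire_property_openin[OF assms(2)] assms(3) by simp

lemma local_orbits_dense_zero_one:
  assumes SH: "local_orbits_dense S H" and D: "meager_in X (S - D)"
    and W: "Baire_property_in X W" "W \<subseteq> S"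
    and inv: "\<And>g x. g \<in> H \<Longrightarrow> x \<in> S \<inter> D \<Longrightarrow> \<phi> g x \<in> S \<inter> D \<Longrightarrow> x \<in> W \<longleftrightarrow> \<phi> g x \<in> W"
  shows "meager_in X W \<or> meager_in X (S - W)"
proof (rule invariant_meager_or_comeager[OF _ _ D _ W inv])
  show "openin X S" "meager_in X {x \<in> S. \<not> S \<subseteq> X closure_of (local_orbit \<phi> S H x)}"
    using SH unfolding local_orbits_dense_def by blast+
  show "H \<subseteq> carrier G"
    using SH openin_subset topspace_TG unfolding local_orbits_dense_def by blast
qed

lemma equiv_related_iff:
  "equiv A F \<Longrightarrow> (x, y) \<in> F \<Longrightarrow> (x, z) \<in> F \<longleftrightarrow> (y, z) \<in> F"
  by (meson equivE symE transE)

text \<open>Composing with \<open>h\<close> turns the problem for \<open>\<theta>\<close> into one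
  over \<open>Z\<close>. Stated for continuous \<open>h\<close>, it covers homeomorphic copies and
  also the coordinate projections, from which products are built.\<close>

lemma ergodic_rel_pullback:
  assumes h: "continuous_map Y Z h" and F: "ergodic_rel Z F"
  shows "ergodic_rel Y (pullback_rel Y h F)"
proof (rule ergodic_relI)
  have hY: "h y \<in> topspace Z" if "y \<in> topspace Y" for y
    using h that by (auto simp: continuous_map_def)
  have E: "equiv (topspace Z) F" using F by (rule ergodic_relD)
  show "equiv (topspace Y) (pullback_rel Y h F)"
  proof (rule equivI)
    show "refl_on (topspace Y) (pullback_rel Y h F)"
      using hY E unfolding equiv_def refl_on_def pullback_rel_def by blast
    show "sym (pullback_rel Y h F)" "trans (pullback_rel Y h F)"
      using E unfolding equiv_def pullback_rel_def sym_def trans_def by blast+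
  qed (auto simp: pullback_rel_def)
  show "measurable_rel {A. Baire_property_in X A} Y (pullback_rel Y h F)"
    "measurable_rel {A. Baire_property_in (prod_topology TG X) A} Y (pullback_rel Y h F)"
    by (intro measurable_rel_pullback[OF h] ergodic_relD[OF F])+
  fix S H D \<theta>
  assume SH: "local_orbits_dense S H" and \<theta>: "measurable_into {A. Baire_property_in X A} S Y \<theta>"
    and inv: "generically_invariant S H D (pullback_rel Y h F) \<theta>"
  have "generically_invariant S H D F (\<lambda>x. h (\<theta> x))"
    using inv unfolding generically_invariant_def pullback_rel_def by blast
  from ergodic_relD(4)[OF F SH measurable_into_compose[OF \<theta> h] this]
  obtain C where C: "C \<subseteq> S" "meager_in X (S - C)" "\<And>x y. x \<in> C \<Longrightarrow> y \<in> C \<Longrightarrow> (h (\<theta> x), h (\<theta> y)) \<in> F"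
    unfolding constant_mod_meager_def by blast
  then show "constant_mod_meager S (pullback_rel Y h F) \<theta>"
    using measurable_intoD(1)[OF \<theta>] unfolding constant_mod_meager_def pullback_rel_def
    by (intro exI[of _ C]) auto
qed

text \<open>Serves as the trivial factor in the description of the Fubini product as a union of
  products.\<close>

lemma ergodic_rel_full: "ergodic_rel Y (topspace Y \<times> topspace Y)"
proof (rule ergodic_relI)
  show "equiv (topspace Y) (topspace Y \<times> topspace Y)"
    by (auto simp: equiv_def refl_on_def sym_def trans_def)
  fix S H D \<theta> assume "measurable_into {A. Baire_property_in X A} S Y \<theta>"
  then show "constant_mod_meager S (topspace Y \<times> topspace Y) \<theta>"
    unfolding constant_mod_meager_def using measurable_intoD(1) by (intro exI[of _ S]) fastforce
qed (rule Baire_property.measurable_rel_full)+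

text \<open>For each basic open \<open>V\<close> the preimage is meager or comeager in
  \<open>S\<close>. Off the countably many exceptional sets all values lie in the same basic sets,
  so they coincide.\<close>

lemma ergodic_rel_Id_on:
  assumes "Polish_space Y" shows "ergodic_rel Y (Id_on (topspace Y))"
proof (rule ergodic_relI)
  show "equiv (topspace Y) (Id_on (topspace Y))"
    by (auto simp: equiv_def refl_on_def sym_def trans_def)
  fix S H D \<theta>
  assume SH: "local_orbits_dense S H" and \<theta>: "measurable_into {A. Baire_property_in X A} S Y \<theta>"
    and inv: "generically_invariant S H D (Id_on (topspace Y)) \<theta>"
  obtain \<B> where \<B>: "countable \<B>" "\<And>V. V \<in> \<B> \<Longrightarrow> openin Y V"
    "\<And>U x. openin Y U \<Longrightarrow> x \<in> U \<Longrightarrow> \<exists>V\<in>\<B>. x \<in> V \<and> V \<subseteq> U"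
    using second_countable_Polish_space[OF assms] unfolding second_countable_def by metis
  have Hausdorff: "Hausdorff_space Y"
    using assms completely_metrizable_imp_metrizable_space metrizable_imp_Hausdorff_space
    unfolding Polish_space_def by blast
  let ?W = "\<lambda>V. {x \<in> S. \<theta> x \<in> V}"
  have W: "meager_in X (?W V) \<or> meager_in X (S - ?W V)" if "V \<in> \<B>" for V
  proof (rule local_orbits_dense_zero_one[OF SH])
    show "meager_in X (S - D)" using inv unfolding generically_invariant_def by blast
    show "Baire_property_in X (?W V)" using measurable_intoD(2)[OF \<theta> \<B>(2)[OF that]] by simp
    show "x \<in> ?W V \<longleftrightarrow> \<phi> g x \<in> ?W V" if "g \<in> H" "x \<in> S \<inter> D" "\<phi> g x \<in> S \<inter> D" for g x
      using inv that unfolding generically_invariant_def by fastforce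
  qed blast
  define N where "N = (\<Union>V\<in>\<B>. if meager_in X (?W V) then ?W V else S - ?W V)"
  have N: "meager_in X N"
    unfolding N_def using W by (intro meager_in_UN \<B>(1)) auto
  have const: "\<theta> x = \<theta> y" if xy: "x \<in> S - N" "y \<in> S - N" for x y
  proof (rule ccontr)
    assume "\<theta> x \<noteq> \<theta> y"
    moreover have "\<theta> x \<in> topspace Y" "\<theta> y \<in> topspace Y" using measurable_intoD(1)[OF \<theta>] xy by auto
    ultimately obtain U U' where U: "openin Y U" "\<theta> x \<in> U" "\<theta> y \<in> U'" "disjnt U U'"
      using Hausdorff unfolding Hausdorff_space_def by blast
    then obtain V where V: "V \<in> \<B>" "\<theta> x \<in> V" "V \<subseteq> U" using \<B>(3) by blast
    then have "x \<in> ?W V" "y \<notin> ?W V" using U xy by (auto simp: disjnt_iff)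
    then show False using xy V(1) unfolding N_def by (cases "meager_in X (?W V)") auto
  qed
  show "constant_mod_meager S (Id_on (topspace Y)) \<theta>"
  proof (rule constant_mod_meagerI[of "S - N"])
    show "meager_in X (S - (S - N))" by (rule meager_in_subset[OF N]) blast
    show "(\<theta> x, \<theta> y) \<in> Id_on (topspace Y)" if xy: "x \<in> S - N" "y \<in> S - N" for x y
      using const[OF xy] measurable_intoD(1)[OF \<theta>, of x] xy(1) by (auto intro: Id_onI)
  qed blast
qed (rule Baire_property.measurable_rel_Id_on[OF assms])+

lemma constant_mod_meager_INT:
  assumes "\<And>k::nat. constant_mod_meager S (F k) (\<theta> k)"
  obtains C where "C \<subseteq> S" "meager_in X (S - C)" "\<And>k x y. x \<in> C \<Longrightarrow> y \<in> C \<Longrightarrow> (\<theta> k x, \<theta> k y) \<in> F k"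
proof -
  obtain C where C: "\<And>k. C k \<subseteq> S" "\<And>k. meager_in X (S - C k)"
    "\<And>k x y. x \<in> C k \<Longrightarrow> y \<in> C k \<Longrightarrow> (\<theta> k x, \<theta> k y) \<in> F k"
    using assms unfolding constant_mod_meager_def by metis
  have "meager_in X (S - (\<Inter>k. C k))"
    by (rule meager_in_subset[OF meager_in_UN_nat[of X "\<lambda>k. S - C k", OF C(2)]]) blast
  moreover have "(\<Inter>k. C k) \<subseteq> S" using C(1) by blast
  moreover have "(\<theta> k x, \<theta> k y) \<in> F k" if "x \<in> (\<Inter>k. C k)" "y \<in> (\<Inter>k. C k)" for k x y
    using C(3)[of x k y] that by blast
  ultimately show thesis by (intro that[of "\<Inter>k. C k"])
qed

lemma ergodic_rel_INT:
  assumes F: "\<And>k::nat. ergodic_rel Y (F k)"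
  shows "ergodic_rel Y (\<Inter>k. F k)"
proof (rule ergodic_relI)
  have E: "equiv (topspace Y) (F k)" for k using F by (rule ergodic_relD)
  show "equiv (topspace Y) (\<Inter>k. F k)"
  proof (rule equivI)
    show "(\<Inter>k. F k) \<subseteq> topspace Y \<times> topspace Y" "refl_on (topspace Y) (\<Inter>k. F k)"
      using E unfolding equiv_def refl_on_def by blast+
    have *: "sym (F k)" "trans (F k)" for k using E unfolding equiv_def by blast+
    show "sym (\<Inter>k. F k)"
      by (intro symI INT_I) (auto intro: symD[OF *(1)])
    show "trans (\<Inter>k. F k)"
      by (intro transI INT_I) (auto intro: transD[OF *(2)])
  qed
  show "measurable_rel {A. Baire_property_in X A} Y (\<Inter>k. F k)"
    "measurable_rel {A. Baire_property_in (prod_topology TG X) A} Y (\<Inter>k. F k)"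
    by (intro Baire_property.measurable_rel_INT ergodic_relD[OF F])+
  fix S H D \<theta>
  assume SH: "local_orbits_dense S H" and \<theta>: "measurable_into {A. Baire_property_in X A} S Y \<theta>"
    and inv: "generically_invariant S H D (\<Inter>k. F k) \<theta>"
  have "constant_mod_meager S (F k) \<theta>" for k
    by (rule ergodic_relD(4)[OF F SH \<theta>]) (use inv in \<open>auto simp: generically_invariant_def\<close>)
  then obtain C where "C \<subseteq> S" "meager_in X (S - C)" "\<And>k x y. x \<in> C \<Longrightarrow> y \<in> C \<Longrightarrow> (\<theta> x, \<theta> y) \<in> F k"
    using constant_mod_meager_INT[of S F "\<lambda>_. \<theta>"] by metis
  then show "constant_mod_meager S (\<Inter>k. F k) \<theta>"
    unfolding constant_mod_meager_def by blast
qed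

text \<open>The product is the intersection of the pullbacks along the coordinate projections;
  pulling back along \<open>id\<close> restricts a relation to the underlying space.\<close>

lemma ergodic_rel_prod:
  assumes F: "\<And>k. ergodic_rel (Y k) (F k)"
  shows "ergodic_rel (product_topology Y UNIV) (pullback_rel (product_topology Y UNIV) id (prod_rel F))"
proof -
  have proj: "continuous_map (product_topology Y UNIV) (Y k) (\<lambda>x. x k)" for k
    by (rule continuous_map_product_projection) simp
  have "ergodic_rel (product_topology Y UNIV)
      (\<Inter>k. pullback_rel (product_topology Y UNIV) (\<lambda>x. x k) (F k))"
    by (intro ergodic_rel_INT ergodic_rel_pullback[OF proj] F)
  moreover have "(\<Inter>k. pullback_rel (product_topology Y UNIV) (\<lambda>x. x k) (F k)) =
      pullback_rel (product_topology Y UNIV) id (prod_rel F)"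
    by (auto simp: pullback_rel_def prod_rel_def)
  ultimately show ?thesis by simp
qed

text \<open>The index of the summand is an invariant with countably many values, so the zero-one law
  makes it generically constant and the problem moves to one summand.\<close>

lemma ergodic_rel_sum:
  assumes F: "\<And>k. ergodic_rel (Y k) (F k)"
  shows "ergodic_rel (sum_topology Y UNIV) (sum_rel F)"
proof (rule ergodic_relI)
  have E: "equiv (topspace (Y k)) (F k)" for k using F by (rule ergodic_relD)
  show "equiv (topspace (sum_topology Y UNIV)) (sum_rel F)"
  proof (rule equivI)
    show "sum_rel F \<subseteq> topspace (sum_topology Y UNIV) \<times> topspace (sum_topology Y UNIV)"
      "refl_on (topspace (sum_topology Y UNIV)) (sum_rel F)"
      using E unfolding equiv_def refl_on_def sum_rel_def by fastforce+
    show "sym (sum_rel F)" "trans (sum_rel F)"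
      using E unfolding equiv_def sym_def trans_def sum_rel_def by blast+
  qed
  show "measurable_rel {A. Baire_property_in X A} (sum_topology Y UNIV) (sum_rel F)"
    "measurable_rel {A. Baire_property_in (prod_topology TG X) A} (sum_topology Y UNIV) (sum_rel F)"
    by (intro Baire_property.measurable_rel_sum ergodic_relD[OF F])+
  fix S H D \<theta>
  assume SH: "local_orbits_dense S H"
    and \<theta>: "measurable_into {A. Baire_property_in X A} S (sum_topology Y UNIV) \<theta>"
    and inv: "generically_invariant S H D (sum_rel F) \<theta>"
  note fst = Baire_property.measurable_into_sum_topology(1)[OF \<theta>]
    and snd = Baire_property.measurable_into_sum_topology(2)[OF \<theta>]
  have S: "openin X S" "S \<noteq> {}" using SH unfolding local_orbits_dense_def by blast+
  have D: "meager_in X (S - D)" using inv unfolding generically_invariant_def by blast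
  have inv': "fst (\<theta> x) = fst (\<theta> (\<phi> g x)) \<and> (snd (\<theta> x), snd (\<theta> (\<phi> g x))) \<in> F (fst (\<theta> x))"
    if "g \<in> H" "x \<in> S \<inter> D" "\<phi> g x \<in> S \<inter> D" for g x
    using inv that unfolding generically_invariant_def by (fastforce simp: sum_rel_def case_prod_beta)
  let ?W = "\<lambda>k. {x \<in> S. fst (\<theta> x) = k}"
  obtain k where k: "\<not> meager_in X (?W k)"
  proof (rule ccontr)
    assume "\<not> thesis"
    then have "meager_in X (\<Union>k. ?W k)" using that by (intro meager_in_UN_nat) blast
    moreover have "(\<Union>k. ?W k) = S" by blast
    ultimately show False using not_meager[OF S] by simp
  qed
  then have W: "meager_in X (S - ?W k)"
    using local_orbits_dense_zero_one[OF SH D, of "?W k"] fst[of k] inv' by auto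
  have "?W k \<noteq> {}" using k by force
  then obtain x0 where x0: "x0 \<in> ?W k" by blast
  \<comment> \<open>Off the generic summand \<open>\<eta>\<close> gets the constant value
    \<open>snd (\<theta> x0)\<close>, so that it maps all of \<open>S\<close> into
    \<open>Y k\<close>. The change is confined to a meager set, which preserves Baire measurability,
    and \<open>D\<close> is cut down to \<open>D \<inter> ?W k\<close>.\<close>
  define \<eta> where "\<eta> x = (if x \<in> ?W k then snd (\<theta> x) else snd (\<theta> x0))" for x
  have "constant_mod_meager S (F k) \<eta>"
  proof (rule ergodic_relD(4)[OF F SH, of _ _ "D \<inter> ?W k"])
    show "measurable_into {A. Baire_property_in X A} S (Y k) \<eta>"
    proof (rule measurable_intoI)
      have "snd (\<theta> z) \<in> topspace (Y k)" if "z \<in> ?W k" for z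
        using measurable_intoD(1)[OF snd that] .
      then show "\<eta> z \<in> topspace (Y k)" for z
        using x0 unfolding \<eta>_def by presburger
      fix U assume "openin (Y k) U"
      then have U: "{x \<in> ?W k. snd (\<theta> x) \<in> U} \<in> {A. Baire_property_in X A}"
        by (rule measurable_intoD(2)[OF snd])
      moreover have "{x \<in> S. \<eta> x \<in> U} = {x \<in> ?W k. snd (\<theta> x) \<in> U} \<union> (if snd (\<theta> x0) \<in> U then S - ?W k else {})"
        unfolding \<eta>_def by auto
      moreover have "S - ?W k \<in> {A. Baire_property_in X A}"
        using W Baire_property_meager by blast
      ultimately show "{x \<in> S. \<eta> x \<in> U} \<in> {A. Baire_property_in X A}"
        using Baire_property.Un[of _ X] by (simp del: mem_Collect_eq split: if_splits)
    qed
    have "meager_in X (S - D \<inter> ?W k)"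
      by (rule meager_in_subset[OF meager_in_Un[OF D W]]) blast
    then show "generically_invariant S H (D \<inter> ?W k) (F k) \<eta>"
      using inv' unfolding generically_invariant_def \<eta>_def by auto
  qed
  then obtain C where C: "C \<subseteq> S" "meager_in X (S - C)" "\<And>x y. x \<in> C \<Longrightarrow> y \<in> C \<Longrightarrow> (\<eta> x, \<eta> y) \<in> F k"
    unfolding constant_mod_meager_def by blast
  have "meager_in X (S - C \<inter> ?W k)"
    by (rule meager_in_subset[OF meager_in_Un[OF C(2) W]]) blast
  moreover have "(\<theta> x, \<theta> y) \<in> sum_rel F" if "x \<in> C \<inter> ?W k" "y \<in> C \<inter> ?W k" for x y
    using C(3)[of x y] that by (auto simp: sum_rel_def \<eta>_def case_prod_beta)
  ultimately show "constant_mod_meager S (sum_rel F) \<theta>"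
    by (intro constant_mod_meagerI[of "C \<inter> ?W k"]) auto
qed

lemma Baire_property_related_set:
  assumes "measurable_rel {A. Baire_property_in X A} Y F" "openin X S"
    "measurable_into {A. Baire_property_in X A} S Y \<theta>" "c \<in> topspace Y"
  shows "Baire_property_in X {x \<in> S. (\<theta> x, c) \<in> F}"
  using measurable_relD[OF assms(1) _ assms(3) Baire_property.measurable_into_const[OF _ assms(4)]]
    Baire_property_openin[OF assms(2)] by simp

text \<open>Right translation by \<open>inv h\<close> is a homeomorphism of the group, so both
  conditions hold generically on the open set of \<open>g\<close> with \<open>g\<close> and
  \<open>g \<otimes> inv h\<close> in \<open>G1\<close>. That set contains \<open>g0\<close>, hence
  is not meager.\<close>

lemma comeager_sections_displacement:
  assumes G1: "openin TG G1" "g0 \<in> G1" and h: "h \<in> carrier G" "g0 \<otimes> inv h \<in> G1"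
    and PQ: "meager_in TG {g \<in> G1. \<not> P g}" "meager_in TG {g \<in> G1. \<not> Q g}"
  obtains g where "g \<in> G1" "g \<otimes> inv h \<in> G1" "P g" "Q (g \<otimes> inv h)"
proof -
  let ?K = "G1 \<inter> {g \<in> topspace TG. g \<otimes> inv h \<in> G1}"
  have "openin TG ?K"
    using openin_continuous_map_preimage[OF continuous_right_translation G1(1), of "inv h"] G1(1) h(1)
    by (intro openin_Int) auto
  moreover have "?K \<noteq> {}" using G1 h openin_subset by blast
  ultimately have "\<not> meager_in TG ?K" by (intro not_meager_open completely_metrizable)
  moreover have "meager_in TG ({g \<in> G1. \<not> P g} \<union> {g \<in> topspace TG. g \<otimes> inv h \<in> {g \<in> G1. \<not> Q g}})"
    using h(1) by (intro meager_in_Un PQ meager_in_vimage[OF continuous_right_translation open_right_translation]) auto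
  ultimately have "\<not> ?K \<subseteq> {g \<in> G1. \<not> P g} \<union> {g \<in> topspace TG. g \<otimes> inv h \<in> {g \<in> G1. \<not> Q g}}"
    using meager_in_subset by blast
  then show thesis using that by blast
qed

end

section \<open>The category step and the closures that rest on it: union, Fubini product,
  power\<close>

locale turbulent_action = polish_action G TG X \<phi>
  for G (structure) and TG :: "'g topology" and X :: "'x topology" and \<phi> +
  assumes turbulent: "meager_in X {x \<in> topspace X. \<not> turbulent_point G TG X \<phi> x}"
begin

text \<open>If \<open>\<alpha> x\<close> and \<open>\<beta> l (\<phi> g x)\<close> are \<open>R l\<close>-related for generic \<open>(g, x)\<close> in a box
  \<open>G1 \<times> X1\<close>, then for \<open>h\<close> near the identity and generic \<open>x\<close> some \<open>g\<close> witnesses both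
  \<open>\<alpha> x\<close> and \<open>\<alpha> (\<phi> h x)\<close> being related to \<open>\<beta> l (\<phi> g x)\<close>, since
  \<open>\<phi> g x = \<phi> (g \<otimes> inv h) (\<phi> h x)\<close>.\<close>

lemma constant_on_open_subset:
  fixes R :: "nat \<Rightarrow> ('y \<times> 'y) set"
  assumes S: "openin X S" "S \<noteq> {}" and H: "openin TG H" "\<one> \<in> H"
    and R: "\<And>l. ergodic_rel Y (R l)"
    and \<alpha>: "measurable_into {A. Baire_property_in X A} S Y \<alpha>"
    and \<beta>: "\<And>l. measurable_into {A. Baire_property_in X A} S Y (\<beta> l)"
    and D: "meager_in X (S - D)"
    and rel: "\<And>h x. h \<in> H \<Longrightarrow> x \<in> S \<inter> D \<Longrightarrow> \<phi> h x \<in> S \<inter> D \<Longrightarrow> \<exists>l. (\<alpha> x, \<beta> l (\<phi> h x)) \<in> R l"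
  obtains l X' where "openin X X'" "X' \<noteq> {}" "X' \<subseteq> S" "constant_mod_meager X' (R l) \<alpha>"
proof -
  let ?T = "prod_topology TG X" and ?a = "\<lambda>(g, x). \<phi> g x"
  let ?BT = "{A. Baire_property_in ?T A}"
  have HG: "H \<subseteq> carrier G" using H openin_subset topspace_TG by blast
  have SX: "S \<subseteq> topspace X" using S openin_subset by blast
  have cs: "continuous_map ?T X snd" and os: "open_map ?T X snd"
    by (auto simp: continuous_map_snd open_map_snd)
  note ca = continuous_act and oa = open_act
  \<comment> \<open>All pairs for which a step of the local action is available; it contains
    \<open>(\<one>, s)\<close> for \<open>s\<close> in \<open>S\<close>.\<close>
  define \<Omega> where "\<Omega> = (H \<times> S) \<inter> {z \<in> topspace ?T. ?a z \<in> S}"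
  have \<Omega>: "openin ?T \<Omega>"
    unfolding \<Omega>_def using H S openin_continuous_map_preimage[OF ca S(1)]
    by (intro openin_Int) (auto simp: openin_prod_Times_iff)
  obtain s where s: "s \<in> S" using S by blast
  have "(\<one>, s) \<in> \<Omega>" using s H SX act_one[of s] unfolding \<Omega>_def by (auto simp: topspace_TG)
  then have "\<Omega> \<noteq> {}" by blast
  have "completely_metrizable_space ?T"
    using completely_metrizable completely_metrizable_space_prod_topology by blast
  then have \<Omega>_nonmeager: "\<not> meager_in ?T \<Omega>" by (rule not_meager_open[OF _ \<Omega> \<open>\<Omega> \<noteq> {}\<close>])
  \<comment> \<open>Used with \<open>f\<close> the projection \<open>snd\<close> and the action map;
    both are continuous and open, so they pull the Baire property back to the product.\<close>
  have meas: "measurable_into ?BT \<Omega> Y (\<lambda>z. \<theta> (f z))"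
    if \<theta>: "measurable_into {A. Baire_property_in X A} S Y \<theta>"
      and f: "continuous_map ?T X f" "open_map ?T X f" "\<And>z. z \<in> \<Omega> \<Longrightarrow> f z \<in> S" for \<theta> f
  proof (rule measurable_intoI)
    show "\<theta> (f z) \<in> topspace Y" if "z \<in> \<Omega>" for z using measurable_intoD(1)[OF \<theta> f(3)[OF that]] .
    fix U assume "openin Y U"
    then have "Baire_property_in X {x \<in> S. \<theta> x \<in> U}" using measurable_intoD(2)[OF \<theta>] by simp
    then have "Baire_property_in ?T (\<Omega> \<inter> {z \<in> topspace ?T. f z \<in> {x \<in> S. \<theta> x \<in> U}})"
      by (intro Baire_property_Int Baire_property_openin[OF \<Omega>] Baire_property_vimage[OF f(1,2)])
    moreover have "\<Omega> \<inter> {z \<in> topspace ?T. f z \<in> {x \<in> S. \<theta> x \<in> U}} = {z \<in> \<Omega>. \<theta> (f z) \<in> U}"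
      using f(3) openin_subset[OF \<Omega>] by blast
    ultimately show "{z \<in> \<Omega>. \<theta> (f z) \<in> U} \<in> ?BT" by simp
  qed
  let ?B = "\<lambda>l. {z \<in> \<Omega>. (\<alpha> (snd z), \<beta> l (?a z)) \<in> R l}"
  have B: "Baire_property_in ?T (?B l)" for l
  proof -
    have "?B l \<in> ?BT"
    proof (rule measurable_relD[OF ergodic_relD(3)[OF R]])
      show "\<Omega> \<in> ?BT" using Baire_property_openin[OF \<Omega>] by simp
      show "measurable_into ?BT \<Omega> Y (\<lambda>z. \<alpha> (snd z))"
        by (rule meas[OF \<alpha> cs os]) (auto simp: \<Omega>_def)
      show "measurable_into ?BT \<Omega> Y (\<lambda>z. \<beta> l (?a z))"
        by (rule meas[OF \<beta> ca oa]) (auto simp: \<Omega>_def)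
    qed
    then show ?thesis by simp
  qed
  have "\<exists>l. \<not> meager_in ?T (?B l)"
  proof (rule ccontr)
    assume "\<not> ?thesis"
    then have "meager_in ?T (\<Union>l. ?B l)" by (intro meager_in_UN_nat) blast
    \<comment> \<open>Invariance says nothing when an end of the step leaves \<open>D\<close>; the
      pairs where this happens lie in two meager preimages of \<open>S - D\<close>.\<close>
    then have "meager_in ?T ((\<Union>l. ?B l) \<union> ({z \<in> topspace ?T. snd z \<in> S - D} \<union> {z \<in> topspace ?T. ?a z \<in> S - D}))"
      by (intro meager_in_Un meager_in_vimage[OF cs os D] meager_in_vimage[OF ca oa D])
    moreover have "\<Omega> \<subseteq> (\<Union>l. ?B l) \<union> ({z \<in> topspace ?T. snd z \<in> S - D} \<union> {z \<in> topspace ?T. ?a z \<in> S - D})"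
    proof
      fix z assume z: "z \<in> \<Omega>"
      obtain h x where hx: "z = (h, x)" by (cases z)
      then have "h \<in> H" "x \<in> S" "\<phi> h x \<in> S" "z \<in> topspace ?T" using z unfolding \<Omega>_def by auto
      moreover have "\<exists>l. (\<alpha> x, \<beta> l (\<phi> h x)) \<in> R l" if "x \<in> D" "\<phi> h x \<in> D"
        using rel[of h x] calculation that by blast
      ultimately show "z \<in> (\<Union>l. ?B l) \<union> ({z \<in> topspace ?T. snd z \<in> S - D} \<union> {z \<in> topspace ?T. ?a z \<in> S - D})"
        using z unfolding hx by auto
    qed
    ultimately show False using \<Omega>_nonmeager meager_in_subset by blast
  qed
  then obtain l where l: "\<not> meager_in ?T (?B l)" by blast
  have "?B l \<subseteq> \<Omega>" by blast
  then obtain P where P: "openin ?T P" "P \<noteq> {}" "P \<subseteq> \<Omega>" "meager_in ?T (P - ?B l)"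
    using Baire_property_nonmeager[OF B l _ \<Omega>] by blast
  then obtain g0 x0 where "(g0, x0) \<in> P" by fast
  then obtain G1 X1 where G1: "openin TG G1" "g0 \<in> G1" and X1: "openin X X1" "x0 \<in> X1" and sub: "G1 \<times> X1 \<subseteq> P"
    using P(1) unfolding openin_prod_topology_alt by meson
  have X1S: "X1 \<subseteq> S" using sub P(3) G1(2) unfolding \<Omega>_def by blast
  have G1G: "G1 \<subseteq> carrier G" using G1 openin_subset topspace_TG by blast
  have "meager_in ?T (G1 \<times> X1 - ?B l)" by (rule meager_in_subset[OF P(4)]) (use sub in blast)
  then obtain Q where Q: "meager_in X Q"
    "\<And>x. x \<in> topspace X - Q \<Longrightarrow> meager_in TG {g. (g, x) \<in> G1 \<times> X1 - ?B l}"
    by (rule meager_in_sections[OF second_countable(2)]) blast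
  have sec: "meager_in TG {g \<in> G1. (\<alpha> x, \<beta> l (\<phi> g x)) \<notin> R l}" if "x \<in> X1 - Q" for x
    by (rule meager_in_subset[OF Q(2)[of x]]) (use that X1S SX in auto)
  \<comment> \<open>The \<open>h\<close> small enough that \<open>g0 \<otimes> inv h\<close> is
    still in \<open>G1\<close>; for these a single \<open>g\<close> can serve the section over
    \<open>x\<close> and, displaced to \<open>g \<otimes> inv h\<close>, the section over
    \<open>\<phi> h x\<close>.\<close>
  let ?H = "{h \<in> carrier G. g0 \<otimes> inv h \<in> G1}"
  have H2: "openin TG ?H" "\<one> \<in> ?H" using openin_displacement[OF G1(1)] G1 G1G by auto
  have "X1 \<noteq> {}" using X1 by blast
  \<comment> \<open>\<open>?H\<close> is dictated by the box, so density of local orbits for it must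
    be restored by shrinking \<open>X1\<close>; this is the use of turbulence.\<close>
  then obtain X' where X': "openin X X'" "X' \<noteq> {}" "X' \<subseteq> X1"
    "meager_in X {x \<in> X'. \<not> X' \<subseteq> X closure_of (local_orbit \<phi> X' ?H x)}"
    by (rule dense_local_orbits[OF turbulent X1(1) _ H2]) blast
  have E: "equiv (topspace Y) (R l)" using R by (rule ergodic_relD)
  have "constant_mod_meager X' (R l) \<alpha>"
  proof (rule ergodic_relD(4)[OF R])
    show "local_orbits_dense X' ?H" using X' H2 unfolding local_orbits_dense_def by blast
    show "measurable_into {A. Baire_property_in X A} X' Y \<alpha>"
      using measurable_into_open_subset[OF \<alpha> X'(1)] X'(3) X1S by blast
    have "(\<alpha> x, \<alpha> (\<phi> h x)) \<in> R l" if h: "h \<in> ?H" and x: "x \<in> X' \<inter> - Q" "\<phi> h x \<in> X' \<inter> - Q" for h x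
    proof -
      have "x \<in> X1 - Q" "\<phi> h x \<in> X1 - Q" using x X'(3) by auto
      then obtain g where g: "g \<in> G1" "g \<otimes> inv h \<in> G1" "(\<alpha> x, \<beta> l (\<phi> g x)) \<in> R l"
        "(\<alpha> (\<phi> h x), \<beta> l (\<phi> (g \<otimes> inv h) (\<phi> h x))) \<in> R l"
        using comeager_sections_displacement[OF G1 _ _ sec sec, of h x "\<phi> h x"] h by blast
      have "x \<in> topspace X" using x(1) X'(1) openin_subset by blast
      then have "\<phi> (g \<otimes> inv h) (\<phi> h x) = \<phi> g x"
        using composition_rule[of x "g \<otimes> inv h" h] g(1) G1G h by (auto simp: m_assoc)
      then show ?thesis using g(3,4) E by (metis equivE symE transE)
    qed
    moreover have "meager_in X (X' - - Q)" by (rule meager_in_subset[OF Q(1)]) blast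
    ultimately show "generically_invariant X' ?H (- Q) (R l) \<alpha>"
      unfolding generically_invariant_def by blast
  qed
  then show thesis using that X' X1S by blast
qed

text \<open>The category step makes \<open>\<theta>\<close> constant modulo a single
  \<open>F l\<close> on an open set. The points related modulo the union to a value taken there form
  a generically invariant set that is not meager, hence comeager in \<open>S\<close>.\<close>

lemma ergodic_rel_UN:
  fixes F :: "nat \<Rightarrow> ('y \<times> 'y) set"
  assumes F: "\<And>k. ergodic_rel Y (F k)" and equiv: "equiv (topspace Y) (\<Union>k. F k)"
  shows "ergodic_rel Y (\<Union>k. F k)"
proof (rule ergodic_relI[OF equiv])
  show meas: "measurable_rel {A. Baire_property_in X A} Y (\<Union>k. F k)"
    "measurable_rel {A. Baire_property_in (prod_topology TG X) A} Y (\<Union>k. F k)"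
    by (intro Baire_property.measurable_rel_UN ergodic_relD[OF F])+
  fix S H D \<theta>
  assume SH: "local_orbits_dense S H" and \<theta>: "measurable_into {A. Baire_property_in X A} S Y \<theta>"
    and inv: "generically_invariant S H D (\<Union>k. F k) \<theta>"
  have S: "openin X S" "S \<noteq> {}" and H: "openin TG H" "\<one> \<in> H"
    using SH unfolding local_orbits_dense_def by blast+
  have D: "meager_in X (S - D)" using inv unfolding generically_invariant_def by blast
  have inv': "(\<theta> x, \<theta> (\<phi> h x)) \<in> (\<Union>k. F k)" if "h \<in> H" "x \<in> S \<inter> D" "\<phi> h x \<in> S \<inter> D" for h x
    using inv that unfolding generically_invariant_def by blast
  have inv'': "\<exists>l. (\<theta> x, \<theta> (\<phi> h x)) \<in> F l" if "h \<in> H" "x \<in> S \<inter> D" "\<phi> h x \<in> S \<inter> D" for h x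
    using inv'[OF that] by blast
  obtain l X' where X': "openin X X'" "X' \<noteq> {}" "X' \<subseteq> S" "constant_mod_meager X' (F l) \<theta>"
    by (rule constant_on_open_subset[where \<beta> = "\<lambda>_. \<theta>", OF S H F \<theta> \<theta> D inv''])
  then obtain C where C: "C \<subseteq> X'" "meager_in X (X' - C)" "\<And>x y. x \<in> C \<Longrightarrow> y \<in> C \<Longrightarrow> (\<theta> x, \<theta> y) \<in> F l"
    using constant_mod_meagerE by blast
  have "C \<noteq> {}" using not_meager[OF X'(1,2)] C(2) by auto
  then obtain c where c: "c \<in> C" by blast
  have cY: "\<theta> c \<in> topspace Y" using measurable_intoD(1)[OF \<theta>] c C(1) X'(3) by blast
  let ?W = "{x \<in> S. (\<theta> x, \<theta> c) \<in> (\<Union>k. F k)}"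
  have "meager_in X ?W \<or> meager_in X (S - ?W)"
  proof (rule local_orbits_dense_zero_one[OF SH D])
    show "Baire_property_in X ?W" by (rule Baire_property_related_set[OF meas(1) S(1) \<theta> cY])
    show "x \<in> ?W \<longleftrightarrow> \<phi> g x \<in> ?W" if "g \<in> H" "x \<in> S \<inter> D" "\<phi> g x \<in> S \<inter> D" for g x
      using equiv_related_iff[OF equiv inv'[OF that]] that by blast
  qed blast
  moreover have "\<not> meager_in X ?W"
  proof
    assume "meager_in X ?W"
    then have "meager_in X ((X' - C) \<union> ?W)" using C(2) meager_in_Un by blast
    moreover have "X' \<subseteq> (X' - C) \<union> ?W" using C(3) c X'(3) by blast
    ultimately show False using not_meager[OF X'(1,2)] meager_in_subset by blast
  qed
  ultimately have "meager_in X (S - ?W)" by blast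
  then show "constant_mod_meager S (\<Union>k. F k) \<theta>"
  proof (rule constant_mod_meagerI[rotated])
    fix x y assume "x \<in> ?W" "y \<in> ?W"
    then have "(\<theta> x, \<theta> c) \<in> (\<Union>k. F k)" "(\<theta> y, \<theta> c) \<in> (\<Union>k. F k)" by blast+
    then show "(\<theta> x, \<theta> y) \<in> (\<Union>k. F k)" using equiv by (metis equivE symE transE)
  qed blast
qed

text \<open>Finitely many failures all lie below some \<open>n\<close>, so they are absorbed by
  making the first \<open>n\<close> factors of a product full. That the union over \<open>n\<close>
  is an equivalence relation is checked separately, as \<open>ergodic_rel_UN\<close> demands
  it.\<close>

lemma ergodic_rel_Fubini:
  assumes F: "\<And>k. ergodic_rel (Y k) (F k)"
  shows "ergodic_rel (product_topology Y UNIV) (pullback_rel (product_topology Y UNIV) id (Fubini_rel F))"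
proof -
  let ?Y = "product_topology Y UNIV"
  let ?F = "\<lambda>n k. if k < n then topspace (Y k) \<times> topspace (Y k) else F k"
  have E: "equiv (topspace (Y k)) (F k)" for k using F by (rule ergodic_relD)
  have "ergodic_rel (Y k) (?F n k)" for n k using F ergodic_rel_full by auto
  then have n: "ergodic_rel ?Y (pullback_rel ?Y id (prod_rel (?F n)))" for n
    by (rule ergodic_rel_prod)
  have eq: "pullback_rel ?Y id (Fubini_rel F) = (\<Union>n. pullback_rel ?Y id (prod_rel (?F n)))"
  proof (intro equalityI subrelI)
    fix x y assume xy: "(x, y) \<in> pullback_rel ?Y id (Fubini_rel F)"
    then have "finite {k. (x k, y k) \<notin> F k}" by (auto simp: pullback_rel_def Fubini_rel_def)
    then obtain n where "\<forall>k\<in>{k. (x k, y k) \<notin> F k}. k < n" using finite_nat_set_iff_bounded by blast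
    then have "(x, y) \<in> pullback_rel ?Y id (prod_rel (?F n))"
      using xy by (auto simp: pullback_rel_def prod_rel_def)
    then show "(x, y) \<in> (\<Union>n. pullback_rel ?Y id (prod_rel (?F n)))" by blast
  next
    fix x y assume "(x, y) \<in> (\<Union>n. pullback_rel ?Y id (prod_rel (?F n)))"
    then obtain n where n: "(x, y) \<in> pullback_rel ?Y id (prod_rel (?F n))" by blast
    then have "(x k, y k) \<in> ?F n k" for k by (auto simp: pullback_rel_def prod_rel_def)
    then have "{k. (x k, y k) \<notin> F k} \<subseteq> {..<n}" by (metis (mono_tags, lifting) lessThan_iff mem_Collect_eq subsetI)
    then have "finite {k. (x k, y k) \<notin> F k}" using finite_subset by blast
    then show "(x, y) \<in> pullback_rel ?Y id (Fubini_rel F)"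
      using n by (auto simp: pullback_rel_def Fubini_rel_def)
  qed
  have "equiv (topspace ?Y) (pullback_rel ?Y id (Fubini_rel F))"
  proof (rule equivI)
    have kE: "refl_on (topspace (Y k)) (F k)" "sym (F k)" "trans (F k)" for k
      using E unfolding equiv_def by blast+
    show "pullback_rel ?Y id (Fubini_rel F) \<subseteq> topspace ?Y \<times> topspace ?Y"
      by (auto simp: pullback_rel_def)
    have "(x k, x k) \<in> F k" if "x \<in> topspace ?Y" for x k
      using refl_onD[OF kE(1)] that by (auto simp: PiE_iff)
    then show "refl_on (topspace ?Y) (pullback_rel ?Y id (Fubini_rel F))"
      by (auto simp: refl_on_def pullback_rel_def Fubini_rel_def)
    have "(x k, y k) \<in> F k \<longleftrightarrow> (y k, x k) \<in> F k" for x y k using symD[OF kE(2)] by blast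
    then show "sym (pullback_rel ?Y id (Fubini_rel F))"
      by (auto simp: sym_def pullback_rel_def Fubini_rel_def)
    show "trans (pullback_rel ?Y id (Fubini_rel F))"
    proof (rule transI)
      fix x y z assume xyz: "(x, y) \<in> pullback_rel ?Y id (Fubini_rel F)" "(y, z) \<in> pullback_rel ?Y id (Fubini_rel F)"
      have "{k. (x k, z k) \<notin> F k} \<subseteq> {k. (x k, y k) \<notin> F k} \<union> {k. (y k, z k) \<notin> F k}"
        using transD[OF kE(3)] by blast
      then have "finite {k. (x k, z k) \<notin> F k}"
        by (rule finite_subset) (use xyz in \<open>auto simp: pullback_rel_def Fubini_rel_def\<close>)
      then show "(x, z) \<in> pullback_rel ?Y id (Fubini_rel F)"
        using xyz by (auto simp: pullback_rel_def Fubini_rel_def)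
    qed
  qed
  then show ?thesis unfolding eq by (intro ergodic_rel_UN n)
qed

text \<open>For each coordinate \<open>k\<close> and each basic open set meeting \<open>S\<close>,
  the category step finds a piece on which that coordinate is generically related to one value
  \<open>c k B\<close>. For fixed \<open>k\<close> the pieces are dense in \<open>S\<close>, so at a
  generic point each coordinate \<open>k\<close> is related to some \<open>c k B\<close>. The
  zero-one law decides for all generic points alike which of these countably many values occur among
  the coordinates.\<close>

lemma ergodic_rel_power:
  fixes Y :: "'y topology"
  assumes F: "ergodic_rel Y F"
  shows "ergodic_rel (product_topology (\<lambda>_::nat. Y) UNIV) (power_rel F)"
proof (rule ergodic_relI)
  let ?Y = "product_topology (\<lambda>_::nat. Y) UNIV"
  have E: "equiv (topspace Y) F" using F by (rule ergodic_relD)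
  then have E': "refl_on (topspace Y) F" "sym F" "trans F" "F \<subseteq> topspace Y \<times> topspace Y"
    unfolding equiv_def by blast+
  show "equiv (topspace ?Y) (power_rel F)"
  proof (rule equivI)
    show "power_rel F \<subseteq> topspace ?Y \<times> topspace ?Y"
      using E'(4) by (fastforce simp: power_rel_def PiE_iff)
    show "refl_on (topspace ?Y) (power_rel F)"
      using refl_onD[OF E'(1)] by (auto simp: refl_on_def power_rel_def PiE_iff)
    show "sym (power_rel F)"
      using symD[OF E'(2)] by (simp add: sym_def power_rel_def) metis
    show "trans (power_rel F)"
      using transD[OF E'(3)] by (simp add: trans_def power_rel_def) metis
  qed
  show "measurable_rel {A. Baire_property_in X A} ?Y (power_rel F)"
    "measurable_rel {A. Baire_property_in (prod_topology TG X) A} ?Y (power_rel F)"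
    by (intro Baire_property.measurable_rel_power ergodic_relD[OF F])+
  fix S H D and \<theta> :: "'x \<Rightarrow> nat \<Rightarrow> 'y"
  assume SH: "local_orbits_dense S H" and \<theta>: "measurable_into {A. Baire_property_in X A} S ?Y \<theta>"
    and inv: "generically_invariant S H D (power_rel F) \<theta>"
  have S: "openin X S" "S \<noteq> {}" and H: "openin TG H" "\<one> \<in> H"
    using SH unfolding local_orbits_dense_def by blast+
  have D: "meager_in X (S - D)" using inv unfolding generically_invariant_def by blast
  have inv': "(\<theta> x, \<theta> (\<phi> h x)) \<in> power_rel F" if "h \<in> H" "x \<in> S \<inter> D" "\<phi> h x \<in> S \<inter> D" for h x
    using inv that unfolding generically_invariant_def by blast
  have proj: "continuous_map ?Y Y (\<lambda>x. x k)" for k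
    using continuous_map_product_projection[of k UNIV "\<lambda>_. Y"] by simp
  have \<theta>k: "measurable_into {A. Baire_property_in X A} S Y (\<lambda>x. \<theta> x k)" for k
    by (rule measurable_into_compose[OF \<theta> proj])
  obtain \<B> where \<B>: "countable \<B>" "\<And>V. V \<in> \<B> \<Longrightarrow> openin X V"
    "\<And>U x. openin X U \<Longrightarrow> x \<in> U \<Longrightarrow> \<exists>V\<in>\<B>. x \<in> V \<and> V \<subseteq> U"
    using second_countable(1) unfolding second_countable_def by metis
  define I where "I = (UNIV :: nat set) \<times> {B \<in> \<B>. B \<inter> S \<noteq> {}}"
  have "countable I" unfolding I_def using \<B>(1) by auto
  define constant_piece where "constant_piece k B X' c \<longleftrightarrow> openin X X' \<and> X' \<noteq> {} \<and> X' \<subseteq> B \<inter> S \<and>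
      c \<in> topspace Y \<and> meager_in X {x \<in> X'. (\<theta> x k, c) \<notin> F}" for k B X' c
  have "\<exists>X' c. constant_piece k B X' c" if "(k, B) \<in> I" for k B
  proof -
    have B: "B \<in> \<B>" "B \<inter> S \<noteq> {}" using that unfolding I_def by auto
    have BS: "openin X (B \<inter> S)" using B \<B>(2) S by blast
    have meas: "measurable_into {A. Baire_property_in X A} (B \<inter> S) Y (\<lambda>x. \<theta> x l)" for l
      using measurable_into_open_subset[OF \<theta>k BS] by blast
    have DB: "meager_in X (B \<inter> S - D)" by (rule meager_in_subset[OF D]) blast
    have rel: "\<exists>l. (\<theta> x k, \<theta> (\<phi> h x) l) \<in> F"
      if "h \<in> H" "x \<in> B \<inter> S \<inter> D" "\<phi> h x \<in> B \<inter> S \<inter> D" for h x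
      using inv'[of h x] that unfolding power_rel_def by blast
    obtain X' where X': "openin X X'" "X' \<noteq> {}" "X' \<subseteq> B \<inter> S" "constant_mod_meager X' F (\<lambda>x. \<theta> x k)"
      by (rule constant_on_open_subset[where \<beta> = "\<lambda>l x. \<theta> x l" and R = "\<lambda>_. F", OF BS B(2) H F meas meas DB rel])
    then obtain C where C: "C \<subseteq> X'" "meager_in X (X' - C)" "\<And>x y. x \<in> C \<Longrightarrow> y \<in> C \<Longrightarrow> (\<theta> x k, \<theta> y k) \<in> F"
      using constant_mod_meagerE by blast
    have "C \<noteq> {}" using not_meager[OF X'(1,2)] C(2) by auto
    then obtain x0 where x0: "x0 \<in> C" by blast
    have "\<theta> x0 k \<in> topspace Y" using measurable_intoD(1)[OF \<theta>k] x0 C(1) X'(3) by blast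
    moreover have "meager_in X {x \<in> X'. (\<theta> x k, \<theta> x0 k) \<notin> F}"
      by (rule meager_in_subset[OF C(2)]) (use C(3) x0 in blast)
    ultimately show ?thesis using X' unfolding constant_piece_def by blast
  qed
  then obtain V c where "\<And>k B. (k, B) \<in> I \<Longrightarrow> constant_piece k B (V k B) (c k B)"
    by metis
  then have V: "\<And>k B. (k, B) \<in> I \<Longrightarrow> openin X (V k B)" "\<And>k B. (k, B) \<in> I \<Longrightarrow> V k B \<noteq> {}"
    "\<And>k B. (k, B) \<in> I \<Longrightarrow> V k B \<subseteq> B \<inter> S"
    and c: "\<And>k B. (k, B) \<in> I \<Longrightarrow> c k B \<in> topspace Y"
    "\<And>k B. (k, B) \<in> I \<Longrightarrow> meager_in X {x \<in> V k B. (\<theta> x k, c k B) \<notin> F}"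
    unfolding constant_piece_def by blast+
  let ?V = "\<lambda>k. \<Union>B\<in>{B \<in> \<B>. B \<inter> S \<noteq> {}}. V k B"
  have V_dense: "nowhere_dense_in X (S - ?V k)" for k
    unfolding nowhere_dense_in_disjoint_iff
  proof (intro conjI allI impI)
    show "S - ?V k \<subseteq> topspace X" using openin_subset[OF S(1)] by blast
    fix U assume U: "openin X U \<and> U \<noteq> {}"
    show "\<exists>W. openin X W \<and> W \<noteq> {} \<and> W \<subseteq> U \<and> W \<inter> (S - ?V k) = {}"
    proof (cases "U \<inter> S = {}")
      case False
      then obtain x where x: "x \<in> U \<inter> S" by blast
      have "openin X (U \<inter> S)" using U S by blast
      then obtain B where B: "B \<in> \<B>" "x \<in> B" "B \<subseteq> U \<inter> S" using \<B>(3) x by blast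
      then have kB: "(k, B) \<in> I" unfolding I_def by blast
      then have "V k B \<subseteq> ?V k" unfolding I_def by blast
      then show ?thesis using V[OF kB] B(3) by (intro exI[of _ "V k B"]) blast
    qed (use U in blast)
  qed
  \<comment> \<open>Points whose sequence contains, at any index \<open>l\<close>, a value related
    to \<open>c k B\<close>. Leaving the index free is what makes the condition invariant, since
    \<open>power_rel\<close> may rearrange coordinates.\<close>
  let ?W = "\<lambda>(k, B). {x \<in> S. \<exists>l. (\<theta> x l, c k B) \<in> F}"
  have W: "meager_in X (?W i) \<or> meager_in X (S - ?W i)" if "i \<in> I" for i
  proof (rule local_orbits_dense_zero_one[OF SH D])
    obtain k B where i: "i = (k, B)" by (cases i)
    have eq: "?W i = (\<Union>l. {x \<in> S. (\<theta> x l, c k B) \<in> F})" unfolding i by auto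
    have "{x \<in> S. (\<theta> x l, c k B) \<in> F} \<in> {A. Baire_property_in X A}" for l
      using Baire_property_related_set[OF ergodic_relD(2)[OF F] S(1) \<theta>k c(1)] that unfolding i by simp
    then have "?W i \<in> {A. Baire_property_in X A}"
      unfolding eq by (intro Baire_property.countable_nat_UN) blast
    then show "Baire_property_in X (?W i)" by simp
    show "?W i \<subseteq> S" unfolding i by auto
    show "x \<in> ?W i \<longleftrightarrow> \<phi> g x \<in> ?W i" if g: "g \<in> H" "x \<in> S \<inter> D" "\<phi> g x \<in> S \<inter> D" for g x
    proof -
      have "(\<exists>l. (\<theta> x l, c k B) \<in> F) \<longleftrightarrow> (\<exists>l. (\<theta> (\<phi> g x) l, c k B) \<in> F)"
        using inv'[OF g] equiv_related_iff[OF E] unfolding power_rel_def mem_Collect_eq case_prod_conv by metis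
      then show ?thesis using g unfolding i by simp
    qed
  qed
  \<comment> \<open>Three exceptional sets: points missed by the pieces of some coordinate, points
    of a piece where the coordinate is not related to the chosen value, and points on the meager
    side of a zero-one alternative.\<close>
  let ?N = "(\<Union>k. S - ?V k) \<union> ((\<Union>(k, B)\<in>I. {x \<in> V k B. (\<theta> x k, c k B) \<notin> F}) \<union>
    (\<Union>i\<in>I. if meager_in X (?W i) then ?W i else S - ?W i))"
  have N: "meager_in X ?N"
  proof (intro meager_in_Un)
    show "meager_in X (\<Union>k. S - ?V k)"
      by (intro meager_in_UN_nat nowhere_dense_imp_meager V_dense)
    show "meager_in X (\<Union>(k, B)\<in>I. {x \<in> V k B. (\<theta> x k, c k B) \<notin> F})"
      using c(2) by (intro meager_in_UN \<open>countable I\<close>) auto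
    show "meager_in X (\<Union>i\<in>I. if meager_in X (?W i) then ?W i else S - ?W i)"
    proof (rule meager_in_UN[OF \<open>countable I\<close>])
      fix i assume "i \<in> I"
      then show "meager_in X (if meager_in X (?W i) then ?W i else S - ?W i)"
        using W[of i] by (cases "meager_in X (?W i)") (simp_all only: if_True if_False simp_thms)
    qed
  qed
  have generic: "z \<in> ?W i \<longleftrightarrow> \<not> meager_in X (?W i)" if "z \<in> S - ?N" "i \<in> I" for z i
  proof -
    have "z \<in> S" "z \<notin> (if meager_in X (?W i) then ?W i else S - ?W i)" using that by blast+
    then show ?thesis
      by (cases "meager_in X (?W i)") (simp_all only: if_True if_False Diff_iff simp_thms)
  qed
  \<comment> \<open>The class of \<open>\<theta> x k\<close> is that of some \<open>c k B\<close>,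
    and the generic points \<open>x\<close> and \<open>y\<close> realise the same
    \<open>c k B\<close>. The other half of \<open>power_rel\<close> follows by exchanging
    \<open>x\<close> and \<open>y\<close>.\<close>
  have half: "\<exists>l. (\<theta> x k, \<theta> y l) \<in> F" if xy: "x \<in> S - ?N" "y \<in> S - ?N" for x y k
  proof -
    have "x \<in> ?V k" using xy(1) by blast
    then obtain B where B: "(k, B) \<in> I" "x \<in> V k B" unfolding I_def by blast
    then have xc: "(\<theta> x k, c k B) \<in> F" using xy(1) by blast
    then have "x \<in> ?W (k, B)" using xy(1) by auto
    then have "y \<in> ?W (k, B)" using generic[OF xy(1) B(1)] generic[OF xy(2) B(1)] by blast
    then show ?thesis using xc E'(2,3) by (auto dest: symD transD)
  qed
  show "constant_mod_meager S (power_rel F) \<theta>"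
  proof (rule constant_mod_meagerI[of "S - ?N"])
    show "meager_in X (S - (S - ?N))" by (rule meager_in_subset[OF N]) blast
    fix x y assume xy: "x \<in> S - ?N" "y \<in> S - ?N"
    show "(\<theta> x, \<theta> y) \<in> power_rel F"
      unfolding power_rel_def mem_Collect_eq case_prod_conv
    proof (intro conjI allI)
      show "\<exists>l. (\<theta> x k, \<theta> y l) \<in> F" for k by (rule half[OF xy])
      show "\<exists>k. (\<theta> x k, \<theta> y l) \<in> F" for l using half[OF xy(2,1), of l] symD[OF E'(2)] by metis
    qed
  qed blast
qed

section \<open>Induction along Class 4\<close>

lemma class4_coded_ergodic_rel:
  "class4_coded Y F \<Longrightarrow> ergodic_rel Y F"
proof (induction rule: class4_coded.induct)
  case (eq Y)
  then show ?case by (rule ergodic_rel_Id_on)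
next
  case (union Y F)
  then show ?case by (intro ergodic_rel_UN)
next
  case (inter Y F)
  then show ?case by (intro ergodic_rel_INT)
next
  case (dsum Y F Z h)
  then show ?case
    using ergodic_rel_pullback[OF homeomorphic_imp_continuous_map ergodic_rel_sum] by blast
next
  case (prod Y F Z h)
  then have "ergodic_rel Z (pullback_rel Z h (pullback_rel (product_topology Y UNIV) id (prod_rel F)))"
    using ergodic_rel_pullback[OF homeomorphic_imp_continuous_map ergodic_rel_prod] by blast
  then show ?case unfolding pullback_rel_comp[OF prod.hyps(2)] by simp
next
  case (Fubini Y F Z h)
  then have "ergodic_rel Z (pullback_rel Z h (pullback_rel (product_topology Y UNIV) id (Fubini_rel F)))"
    using ergodic_rel_pullback[OF homeomorphic_imp_continuous_map ergodic_rel_Fubini] by blast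
  then show ?case unfolding pullback_rel_comp[OF Fubini.hyps(2)] by simp
next
  case (power Y F Z h)
  then show ?case
    using ergodic_rel_pullback[OF homeomorphic_imp_continuous_map ergodic_rel_power] by blast
qed

lemma class4_ergodic_rel:
  assumes "class4 Y F" shows "ergodic_rel Y F"
proof -
  obtain Z E h where "class4_coded Z E" "homeomorphic_map Y Z h" "F = pullback_rel Y h E"
    using assms unfolding class4_def by blast
  then show ?thesis
    using ergodic_rel_pullback class4_coded_ergodic_rel homeomorphic_imp_continuous_map by blast
qed

end

section \<open>Open subspaces, hereditary ergodicity and full orbits\<close>

lemma nowhere_dense_in_open_subtopology:
  assumes "openin X S"
  shows "nowhere_dense_in (subtopology X S) A \<longleftrightarrow> nowhere_dense_in X A \<and> A \<subseteq> S"
proof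
  have SX: "S \<subseteq> topspace X" using assms by (rule openin_subset)
  then have top: "topspace (subtopology X S) = S" by auto
  assume L: "nowhere_dense_in (subtopology X S) A"
  then have AS: "A \<subseteq> S" unfolding nowhere_dense_in_def top by blast
  have "\<exists>V. openin X V \<and> V \<noteq> {} \<and> V \<subseteq> U \<and> V \<inter> A = {}" if U: "openin X U" "U \<noteq> {}" for U
  proof (cases "U \<inter> S = {}")
    case True
    then show ?thesis using U AS by (intro exI[of _ U]) blast
  next
    case False
    have "openin (subtopology X S) (U \<inter> S)"
      using U assms by (simp add: openin_open_subtopology openin_Int)
    then obtain V where "openin (subtopology X S) V" "V \<noteq> {}" "V \<subseteq> U \<inter> S" "V \<inter> A = {}"
      using L False unfolding nowhere_dense_in_disjoint_iff by blast
    then show ?thesis using assms by (intro exI[of _ V]) (auto simp: openin_open_subtopology)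
  qed
  then show "nowhere_dense_in X A \<and> A \<subseteq> S"
    unfolding nowhere_dense_in_disjoint_iff[of X] using AS SX by auto
next
  assume "nowhere_dense_in X A \<and> A \<subseteq> S"
  then show "nowhere_dense_in (subtopology X S) A"
    using openin_subset[OF assms]
    unfolding nowhere_dense_in_disjoint_iff openin_open_subtopology[OF assms] topspace_subtopology
    by (metis Int_subset_iff order_trans)
qed

lemma meager_in_open_subtopology:
  assumes "openin X S"
  shows "meager_in (subtopology X S) A \<longleftrightarrow> meager_in X A \<and> A \<subseteq> S"
proof
  assume "meager_in (subtopology X S) A"
  then obtain N where N: "\<And>n. nowhere_dense_in (subtopology X S) (N n)" "A \<subseteq> (\<Union>n. N (n::nat))"
    unfolding meager_in_def by blast
  then have "nowhere_dense_in X (N n)" "N n \<subseteq> S" for n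
    using nowhere_dense_in_open_subtopology[OF assms] by blast+
  then show "meager_in X A \<and> A \<subseteq> S" using N(2) unfolding meager_in_def by blast
next
  assume A: "meager_in X A \<and> A \<subseteq> S"
  then obtain N where N: "\<And>n. nowhere_dense_in X (N n)" "A \<subseteq> (\<Union>n. N (n::nat))"
    unfolding meager_in_def by blast
  have "nowhere_dense_in (subtopology X S) (N n \<inter> S)" for n
    unfolding nowhere_dense_in_open_subtopology[OF assms]
    using nowhere_dense_in_subset[OF N(1)] by blast
  moreover have "A \<subseteq> (\<Union>n. N n \<inter> S)" using N(2) A by blast
  ultimately show "meager_in (subtopology X S) A"
    unfolding meager_in_def by (intro exI[of _ "\<lambda>n. N n \<inter> S"] conjI allI)
qed

lemma Baire_property_open_subtopology:
  assumes "openin X S" "Baire_property_in (subtopology X S) A"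
  shows "Baire_property_in X A"
proof -
  obtain U where U: "openin (subtopology X S) U" "meager_in (subtopology X S) ((A - U) \<union> (U - A))"
    and A: "A \<subseteq> topspace (subtopology X S)"
    using assms(2) unfolding Baire_property_in_def by blast
  then have "openin X U" "meager_in X ((A - U) \<union> (U - A))" "A \<subseteq> topspace X"
    using meager_in_open_subtopology[OF assms(1)] openin_open_subtopology[OF assms(1)] by auto
  then show ?thesis unfolding Baire_property_in_def by blast
qed

context polish_action
begin

text \<open>Since \<open>S\<close> is open, category, density and the Baire property in the subspace
  can be read in \<open>X\<close>; exact invariance is generic invariance with
  \<open>D = UNIV\<close>.\<close>

lemma ergodic_rel_imp_hereditarily_generically_ergodic:
  assumes F: "ergodic_rel Y F"
  shows "hereditarily_generically_ergodic G TG X \<phi> Y F"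
  unfolding hereditarily_generically_ergodic_def generically_ergodic_def
proof (intro allI impI, elim conjE)
  fix S H \<theta>
  let ?X = "subtopology X S"
  assume S: "openin X S" "S \<noteq> {}" and H: "openin TG H" "\<one> \<in> H"
    and dense: "comeager_in ?X {x \<in> S. dense_in ?X (local_orbit \<phi> S H x)}"
    and \<theta>: "Baire_measurable ?X Y \<theta>" and inv: "invariant_map ?X (local_equiv \<phi> H S) F \<theta>"
  have top: "topspace ?X = S" using openin_subset[OF S(1)] by auto
  have "constant_mod_meager S F \<theta>"
  proof (rule ergodic_relD(4)[OF F])
    have "meager_in X (S - {x \<in> S. dense_in ?X (local_orbit \<phi> S H x)})"
      using dense unfolding comeager_in_def top meager_in_open_subtopology[OF S(1)] by blast
    moreover have "S \<subseteq> X closure_of local_orbit \<phi> S H x"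
      if "dense_in ?X (local_orbit \<phi> S H x)" for x
    proof -
      have "S = S \<inter> X closure_of (S \<inter> local_orbit \<phi> S H x)"
        using that unfolding dense_in_def top closure_of_subtopology by simp
      also have "\<dots> \<subseteq> X closure_of local_orbit \<phi> S H x"
        using closure_of_mono[of "S \<inter> local_orbit \<phi> S H x" "local_orbit \<phi> S H x" X] by blast
      finally show ?thesis .
    qed
    then have "{x \<in> S. \<not> S \<subseteq> X closure_of local_orbit \<phi> S H x} \<subseteq>
        S - {x \<in> S. dense_in ?X (local_orbit \<phi> S H x)}" by blast
    ultimately show "local_orbits_dense S H"
      using S H meager_in_subset unfolding local_orbits_dense_def by blast
    show "measurable_into {A. Baire_property_in X A} S Y \<theta>"
      using \<theta> Baire_property_open_subtopology[OF S(1)]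
      unfolding Baire_measurable_def measurable_into_def top by simp
    have "(\<theta> x, \<theta> (\<phi> h x)) \<in> F" if "h \<in> H" "x \<in> S" "\<phi> h x \<in> S" for h x
      using inv local_orbit_step[OF that, of \<phi>] that unfolding invariant_map_def top local_orbit_def by simp
    then show "generically_invariant S H UNIV F \<theta>"
      unfolding generically_invariant_def by simp
  qed
  then obtain C where C: "C \<subseteq> S" "meager_in X (S - C)" "\<And>x y. x \<in> C \<Longrightarrow> y \<in> C \<Longrightarrow> (\<theta> x, \<theta> y) \<in> F"
    using constant_mod_meagerE by blast
  have "comeager_in ?X C"
    unfolding comeager_in_def top meager_in_open_subtopology[OF S(1)] using C by blast
  then show "generically_constant ?X F \<theta>"
    unfolding generically_constant_def using C(3) by blast
qed

text \<open>Links the orbits in the definition of generic turbulence with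
  \<open>orbit_equiv\<close>, which is generated by steps: over the whole group one step already
  reaches every point of the orbit.\<close>

lemma local_orbit_topspace:
  assumes x: "x \<in> topspace X"
  shows "local_orbit \<phi> (topspace X) (carrier G) x = orbit G \<phi> x"
proof
  show "orbit G \<phi> x \<subseteq> local_orbit \<phi> (topspace X) (carrier G) x"
    using x act_closed by (auto simp: orbit_def intro!: local_orbit_step)
  have shift: "\<phi> g y \<in> orbit G \<phi> x" if "g \<in> carrier G" "y \<in> orbit G \<phi> x" for g y
  proof -
    obtain h where "h \<in> carrier G" "y = \<phi> h x" using \<open>y \<in> orbit G \<phi> x\<close> unfolding orbit_def by blast
    then show ?thesis
      using composition_rule[OF x \<open>g \<in> carrier G\<close>, of h] \<open>g \<in> carrier G\<close>
      unfolding orbit_def mem_Collect_eq by (intro exI[of _ "g \<otimes> h"]) simp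
  qed
  have "y \<in> orbit G \<phi> x \<longleftrightarrow> \<phi> g y \<in> orbit G \<phi> x" if "g \<in> carrier G" "y \<in> topspace X" for g y
    using shift[of g y] shift[of "inv g" "\<phi> g y"] act_inv[OF that] that(1) by auto
  then show "local_orbit \<phi> (topspace X) (carrier G) x \<subseteq> orbit G \<phi> x"
    using local_orbit_invariant[of "carrier G" "topspace X" \<phi> "orbit G \<phi> x" x] x orbit_refl[OF x] by blast
qed

end

theorem theorem2p3:
  fixes G :: "('g, 'm) monoid_scheme" and TG :: "'g topology"
    and X :: "'x topology" and \<phi> :: "'g \<Rightarrow> 'x \<Rightarrow> 'x"
    and Y :: "'y topology" and F :: "('y \<times> 'y) set"
  assumes "Polish_group G TG"
    and "Polish_space X" and "topspace X \<noteq> {}"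
    and "continuous_action G TG X \<phi>"
    and "generically_turbulent G TG X \<phi>"
    and "Polish_space Y"
    and "equiv (topspace Y) F"
    and "class4 Y F"
  shows "hereditarily_generically_ergodic G TG X \<phi> Y F
    \<and> \<not> Baire_reducible X (orbit_equiv G X \<phi>) Y F"
proof
  interpret polish_action G TG X \<phi>
    using assms(1,2,4) by (rule polish_action.intro)
  let ?orb = "local_orbit \<phi> (topspace X) (carrier G)"
  let ?U = "\<Union>{Q \<in> orbits G (topspace X) \<phi>.
    dense_in X Q \<and> (\<forall>x\<in>Q. turbulent_point G TG X \<phi> x) \<and> meager_in X Q}"
  have U: "meager_in X (topspace X - ?U)"
    using assms(5) unfolding generically_turbulent_def comeager_in_def by blast
  have "{x \<in> topspace X. \<not> turbulent_point G TG X \<phi> x} \<subseteq> topspace X - ?U" by blast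
  then interpret turbulent_action G TG X \<phi>
    using meager_in_subset[OF U] by unfold_locales
  show hered: "hereditarily_generically_ergodic G TG X \<phi> Y F"
    by (intro ergodic_rel_imp_hereditarily_generically_ergodic class4_ergodic_rel assms(8))
  have orb: "dense_in X (?orb x) \<and> meager_in X (?orb x)" if xU: "x \<in> ?U" for x
  proof -
    obtain Q where Q: "x \<in> Q" "Q \<in> orbits G (topspace X) \<phi>" "dense_in X Q" "meager_in X Q"
      using xU by blast
    then obtain y where "y \<in> topspace X" "Q = orbit G \<phi> y" unfolding orbits_def by blast
    then have "Q = ?orb y" using local_orbit_topspace by simp
    then show ?thesis using Q local_orbit_eq by metis
  qed
  show "\<not> Baire_reducible X (orbit_equiv G X \<phi>) Y F"
  proof
    assume "Baire_reducible X (orbit_equiv G X \<phi>) Y F"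
    then obtain \<theta> where \<theta>: "Baire_measurable X Y \<theta>"
      "\<And>x y. x \<in> topspace X \<Longrightarrow> y \<in> topspace X \<Longrightarrow> (x, y) \<in> orbit_equiv G X \<phi> \<longleftrightarrow> (\<theta> x, \<theta> y) \<in> F"
      unfolding Baire_reducible_def by blast
    have "topspace X - {x \<in> topspace X. dense_in X (?orb x)} \<subseteq> topspace X - ?U"
      using orb by blast
    then have "comeager_in X {x \<in> topspace X. dense_in X (?orb x)}"
      using meager_in_subset[OF U] unfolding comeager_in_def by blast
    moreover have "openin TG (carrier G)" using topspace_TG openin_topspace by metis
    \<comment> \<open>Hereditary ergodicity is applied to the whole space and the whole group; the
      dense orbits making up \<open>?U\<close> supply its hypothesis.\<close>
    ultimately have "generically_ergodic X (orbit_equiv G X \<phi>) Y F"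
      using hered[unfolded hereditarily_generically_ergodic_def, rule_format, of "topspace X" "carrier G"] assms(3)
      unfolding orbit_equiv_def subtopology_topspace by simp
    moreover have "invariant_map X (orbit_equiv G X \<phi>) F \<theta>"
      using \<theta>(2) unfolding invariant_map_def by blast
    ultimately have "generically_constant X F \<theta>"
      using \<theta>(1) unfolding generically_ergodic_def by blast
    then obtain C where C: "C \<subseteq> topspace X" "meager_in X (topspace X - C)" "\<And>x y. x \<in> C \<Longrightarrow> y \<in> C \<Longrightarrow> (\<theta> x, \<theta> y) \<in> F"
      unfolding generically_constant_def comeager_in_def by blast
    have nonmeager: "\<not> meager_in X (topspace X)" using not_meager assms(3) by blast
    then have "\<not> topspace X \<subseteq> (topspace X - C) \<union> (topspace X - ?U)"
      using meager_in_subset[OF meager_in_Un[OF C(2) U]] by blast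
    \<comment> \<open>Besides lying in \<open>C\<close>, the point is taken in \<open>?U\<close>,
      where orbits are known to be meager.\<close>
    then obtain x where x: "x \<in> C" "x \<in> ?U" by blast
    have "C \<subseteq> ?orb x"
    proof
      fix y assume "y \<in> C"
      then have "(x, y) \<in> orbit_equiv G X \<phi>" using \<theta>(2) C x(1) by blast
      then show "y \<in> ?orb x" unfolding local_orbit_def orbit_equiv_def by blast
    qed
    then have "topspace X \<subseteq> (topspace X - C) \<union> ?orb x" by blast
    then show False
      using meager_in_subset[OF meager_in_Un[OF C(2)]] orb[OF x(2)] nonmeager by blast
  qed
qed

end
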